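(* Let $\mathcal{L}_n$ be the variety of Lie brackets on $\mathbb{C}^n$. (i) The $\mathrm{GL}(n)$-orbit of any semisimple Lie algebra $\mu\in\mathcal{L}_n$ is open in $\mathcal{L}_n$. (ii) The $\mathrm{SL}(n)$-orbit of $\mu\in\mathcal{L}_n$ is closed if and only if $\mu$ is semisimple. (iii) $0\in\overline{\mathrm{SL}(n).\lambda}$ for any non-semisimple $\lambda\in\mathcal{L}_n$.
   Context: $V_n=\Lambda^2(\mathbb{C}^n)^*\otimes\mathbb{C}^n$ is the space of alternating bilinear maps $\mathbb{C}^n\times\mathbb{C}^n\to\mathbb{C}^n$, and $\mathcal{L}_n\subset V_n$ is the algebraic subset of those $\mu$ satisfying the Jacobi identity. $\mathrm{GL}(n)=\mathrm{GL}(n,\mathbb{C})$ and its subgroup $\mathrm{SL}(n)=\mathrm{SL}(n,\mathbb{C})$ act on $V_n$ by $g.\mu(X,Y)=g\mu(g^{-1}X,g^{-1}Y)$, preserving $\mathcal{L}_n$. The bar denotes closure of the orbit in $V_n$.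
   Formalization: Part (ii) is stated for nonzero μ only: for μ = 0 the SL(n)-orbit is {0}, which is closed, although the abelian Lie algebra C^n (n ≥ 1) is not semisimple. *)

theory Defs
  imports "HOL-Analysis.Analysis"
begin

text \<open>
  The dimension $n \ge 1$ is the cardinality of the index type \<open>'n\<close>.  A bracket is a function of
  two vectors, so subsets of the bracket space carry the topology of pointwise convergence
  (the library's topology on function types); the lemma \<open>alternating_maps_homeomorphism\<close> below
  shows that on the space of alternating bilinear maps this is the usual Euclidean topology of
  the structure constants.
\<close>

type_synonym 'n bracket = "complex^'n \<Rightarrow> complex^'n \<Rightarrow> complex^'n"

definition alternating_maps :: "('n::finite) bracket set" where
  "alternating_maps = {\<mu>.
     (\<forall>X. Vector_Spaces.linear (*s) (*s) (\<mu> X)) \<and>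
     (\<forall>Y. Vector_Spaces.linear (*s) (*s) (\<lambda>X. \<mu> X Y)) \<and>
     (\<forall>X. \<mu> X X = 0)}"

definition lie_brackets :: "('n::finite) bracket set" where
  "lie_brackets = {\<mu> \<in> alternating_maps.
     \<forall>X Y Z. \<mu> X (\<mu> Y Z) + \<mu> Y (\<mu> Z X) + \<mu> Z (\<mu> X Y) = 0}"

definition general_linear :: "(complex^'n^'n::finite) set" where
  "general_linear = {g. invertible g}"

definition special_linear :: "(complex^'n^'n::finite) set" where
  "special_linear = {g. det g = 1}"

definition bracket_action :: "complex^'n^'n::finite \<Rightarrow> 'n bracket \<Rightarrow> 'n bracket" where
  "bracket_action g \<mu> = (\<lambda>X Y. g *v \<mu> (matrix_inv g *v X) (matrix_inv g *v Y))"

definition bracket_orbit :: "(complex^'n^'n::finite) set \<Rightarrow> 'n bracket \<Rightarrow> 'n bracket set" where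
  "bracket_orbit G \<mu> = (\<lambda>g. bracket_action g \<mu>) ` G"

definition zero_bracket :: "('n::finite) bracket" where
  "zero_bracket = (\<lambda>X Y. 0)"

definition lie_ideal :: "('n::finite) bracket \<Rightarrow> (complex^'n) set \<Rightarrow> bool" where
  "lie_ideal \<mu> I \<longleftrightarrow> vec.subspace I \<and> (\<forall>X. \<forall>Y\<in>I. \<mu> X Y \<in> I)"

primrec derived_series :: "('n::finite) bracket \<Rightarrow> (complex^'n) set \<Rightarrow> nat \<Rightarrow> (complex^'n) set" where
  "derived_series \<mu> I 0 = I"
| "derived_series \<mu> I (Suc k) =
     vec.span {\<mu> X Y | X Y. X \<in> derived_series \<mu> I k \<and> Y \<in> derived_series \<mu> I k}"

definition lie_solvable :: "('n::finite) bracket \<Rightarrow> (complex^'n) set \<Rightarrow> bool" where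
  "lie_solvable \<mu> I \<longleftrightarrow> (\<exists>k. derived_series \<mu> I k = {0})"

text \<open>Semisimplicity is vanishing of the solvable radical, i.e. of the largest solvable ideal.\<close>

definition lie_semisimple :: "('n::finite) bracket \<Rightarrow> bool" where
  "lie_semisimple \<mu> \<longleftrightarrow> (\<forall>I. lie_ideal \<mu> I \<and> lie_solvable \<mu> I \<longrightarrow> I = {0})"

definition structure_constants :: "('n::finite) bracket \<Rightarrow> complex^'n^'n^'n" where
  "structure_constants \<mu> = (\<chi> i j. \<mu> (axis i 1) (axis j 1))"

definition bracket_of_constants :: "complex^'n^'n^'n \<Rightarrow> ('n::finite) bracket" where
  "bracket_of_constants c = (\<lambda>X Y. \<Sum>i\<in>UNIV. \<Sum>j\<in>UNIV. (X $ i * Y $ j) *s (c $ i $ j))"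

lemma alternating_maps_expand:
  assumes "\<mu> \<in> alternating_maps"
  shows "bracket_of_constants (structure_constants \<mu>) = \<mu>"
proof (intro ext)
  fix X Y
  have l: "Vector_Spaces.linear (*s) (*s) (\<mu> X)" "Vector_Spaces.linear (*s) (*s) (\<lambda>X. \<mu> X Y)" for X Y
    using assms by (auto simp: alternating_maps_def)
  have "\<mu> X Y = \<mu> (\<Sum>i\<in>UNIV. X $ i *s axis i 1) Y"
    by (simp add: basis_expansion)
  also have "\<dots> = (\<Sum>i\<in>UNIV. X $ i *s \<mu> (axis i 1) Y)"
    by (simp only: vec.linear_sum[OF l(2)[of Y]] vec.linear_scale[OF l(2)[of Y]])
  also have "\<dots> = (\<Sum>i\<in>UNIV. X $ i *s \<mu> (axis i 1) (\<Sum>j\<in>UNIV. Y $ j *s axis j 1))"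
    by (simp add: basis_expansion)
  also have "\<dots> = (\<Sum>i\<in>UNIV. X $ i *s (\<Sum>j\<in>UNIV. Y $ j *s \<mu> (axis i 1) (axis j 1)))"
    by (simp only: vec.linear_sum[OF l(1)] vec.linear_scale[OF l(1)])
  also have "\<dots> = bracket_of_constants (structure_constants \<mu>) X Y"
    by (simp add: bracket_of_constants_def structure_constants_def vec.scale_sum_right)
  finally show "bracket_of_constants (structure_constants \<mu>) X Y = \<mu> X Y" by simp
qed

lemma alternating_maps_homeomorphism:
  "homeomorphism alternating_maps (structure_constants ` alternating_maps)
     structure_constants (bracket_of_constants :: _ \<Rightarrow> ('n::finite) bracket)"
proof -
  have c: "continuous_on UNIV (\<lambda>\<mu>::'n bracket. \<mu> X Y)" for X Y
    by (rule continuous_on_product_then_coordinatewise)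
       (rule continuous_on_product_coordinates)
  have 1: "continuous_on S (structure_constants :: 'n bracket \<Rightarrow> _)" for S
    unfolding structure_constants_def
    by (intro continuous_intros continuous_on_subset[OF c]) auto
  have 2: "continuous_on S (bracket_of_constants :: _ \<Rightarrow> 'n bracket)" for S
    unfolding bracket_of_constants_def vector_scalar_mult_def
    by (intro continuous_on_coordinatewise_then_product continuous_intros)
  show ?thesis
    unfolding homeomorphism_def
    using 1 2 by (auto simp: alternating_maps_expand image_image)
qed

end

theory Submission
  imports Defs "HOL-Computational_Algebra.Fundamental_Theorem_Algebra"
begin

text \<open>
  If \<open>\<mu>\<close> is not semisimple, it has a nonzero abelian ideal, and a one-parameter subgroup of
  \<open>SL(n)\<close> that contracts this ideal and expands a complement degenerates \<open>\<mu>\<close> to zero.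

  If \<open>\<mu>\<close> is semisimple, its Killing form is nondegenerate by Cartan's criterion. The Casimir element of the
  Killing form then acts as the identity in the adjoint representation and provides an explicit contracting homotopy
  \<open>f = d k f + k d f\<close> on 2-cochains, so \<open>H\<^sup>2\<close> vanishes. A submersion argument turns this into
  rigidity: every Lie bracket close to \<open>\<mu>\<close> is \<open>g.\<mu>\<close> with \<open>g\<close> close to the identity. This is openness
  of the \<open>GL(n)\<close>-orbit. The determinant of the Killing form is constant on the closure of the
  \<open>SL(n)\<close>-orbit, so a limit \<open>\<nu>\<close> of the orbit is again rigid and satisfies \<open>\<nu> = g.\<mu>\<close>
  with \<open>(det g)\<^sup>2 = 1\<close> and \<open>det g\<close> close to 1.
\<close>

section \<open>The Killing form\<close>

text \<open>The variety of Lie brackets may be singular, so openness of an orbit does not follow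
  from a tangent space computation alone. For \<open>\<mu> + w\<close> it reads
  \<open>d w + J(w, w) = 0\<close>, with \<open>J\<close> the \<open>jacobiator\<close>. On the
  transverse slice \<open>k d\<close> is the identity, so the equation becomes
  \<open>w = - k J(w, w)\<close>, which is purely quadratic and has 0 as its only small solution. An
  explicit operator \<open>k\<close>, as opposed to bare vanishing of cohomology, supplies both the
  right inverse of the derivative and this estimate.

  The zero bracket is the exception in (ii): its orbit is a point, hence closed, while an abelian
  algebra of positive dimension is not semisimple.\<close>

abbreviation clinear :: "(complex^'n::finite \<Rightarrow> complex^'m::finite) \<Rightarrow> bool" where
  "clinear \<equiv> Vector_Spaces.linear (*s) (*s)"

lemma clinearI:
  assumes "\<And>x y. f (x + y) = f x + f y" "\<And>c x. f (c *s x) = c *s f x"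
  shows "clinear f"
  using assms by unfold_locales auto

lemma clinear_basis:
  assumes "clinear f"
  shows "f x = (\<Sum>i\<in>UNIV. x $ i *s f (axis i 1))"
proof -
  have "f x = f (\<Sum>i\<in>UNIV. x $ i *s axis i 1)"
    by (simp add: basis_expansion)
  then show ?thesis
    by (simp only: vec.linear_sum[OF assms] vec.linear_scale[OF assms])
qed

lemma matrix_inv_mult:
  fixes A :: "'a::semiring_1^'n^'m"
  assumes "invertible A"
  shows "A ** matrix_inv A = mat 1" "matrix_inv A ** A = mat 1"
  using someI_ex[OF assms[unfolded invertible_def]] unfolding matrix_inv_def by auto

definition op_trace :: "(complex^'n \<Rightarrow> complex^'n::finite) \<Rightarrow> complex" where
  "op_trace f = (\<Sum>i\<in>UNIV. f (axis i 1) $ i)"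

lemma op_trace_add: "op_trace (\<lambda>z. f z + g z) = op_trace f + op_trace g"
  by (simp add: op_trace_def sum.distrib)

lemma op_trace_diff: "op_trace (\<lambda>z. f z - g z) = op_trace f - op_trace g"
  by (simp add: op_trace_def sum_subtractf)

lemma op_trace_scale: "op_trace (\<lambda>z. c *s f z) = c * op_trace f"
  by (simp add: op_trace_def sum_distrib_left)

lemma op_trace_commute:
  assumes "clinear f" "clinear g"
  shows "op_trace (\<lambda>z. f (g z)) = op_trace (\<lambda>z. g (f z))"
proof -
  have "op_trace (\<lambda>z. f (g z)) = (\<Sum>i\<in>UNIV. \<Sum>j\<in>UNIV. g (axis i 1) $ j * f (axis j 1) $ i)"
    unfolding op_trace_def
    by (subst clinear_basis[OF assms(1)]) simp
  also have "\<dots> = (\<Sum>j\<in>UNIV. \<Sum>i\<in>UNIV. f (axis j 1) $ i * g (axis i 1) $ j)"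
    by (subst sum.swap) (simp add: mult.commute)
  also have "\<dots> = op_trace (\<lambda>z. g (f z))"
    unfolding op_trace_def
    by (subst (2) clinear_basis[OF assms(2)]) simp
  finally show ?thesis .
qed

definition killing :: "('n::finite) bracket \<Rightarrow> complex^'n \<Rightarrow> complex^'n \<Rightarrow> complex" where
  "killing \<mu> x y = op_trace (\<lambda>z. \<mu> x (\<mu> y z))"

definition killing_nondegenerate :: "('n::finite) bracket \<Rightarrow> bool" where
  "killing_nondegenerate \<mu> \<longleftrightarrow> (\<forall>x. (\<forall>y. killing \<mu> x y = 0) \<longrightarrow> x = 0)"

text \<open>Two bracket arguments, so that the Jacobi expression polarizes: for bilinear maps, its
  value on \<open>\<mu> + w\<close> is the sum of the values at \<open>(\<mu>, \<mu>)\<close>,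
  \<open>(\<mu>, w)\<close>, \<open>(w, \<mu>)\<close> and \<open>(w, w)\<close>.\<close>

definition jacobiator :: "('n::finite) bracket \<Rightarrow> 'n bracket \<Rightarrow> complex^'n \<Rightarrow> complex^'n \<Rightarrow> complex^'n \<Rightarrow> complex^'n" where
  "jacobiator f g x y z = f x (g y z) + f y (g z x) + f z (g x y)"

locale alternating_map =
  fixes \<mu> :: "('n::finite) bracket"
  assumes alternating: "\<mu> \<in> alternating_maps"
begin

lemma linear_right: "clinear (\<mu> x)" and linear_left: "clinear (\<lambda>x. \<mu> x y)"
  and self [simp]: "\<mu> x x = 0"
  using alternating by (auto simp: alternating_maps_def)

lemmas add_right = vec.linear_add[OF linear_right]
lemmas add_left = vec.linear_add[OF linear_left]
lemmas diff_right = vec.linear_diff[OF linear_right]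
lemmas diff_left = vec.linear_diff[OF linear_left]
lemmas neg_right = vec.linear_neg[OF linear_right]
lemmas scale_right = vec.linear_scale[OF linear_right]
lemmas scale_left = vec.linear_scale[OF linear_left]
lemmas sum_right = vec.linear_sum[OF linear_right]
lemma zero_right [simp]: "\<mu> x 0 = 0" by (rule vec.linear_0[OF linear_right])
lemma zero_left [simp]: "\<mu> 0 x = 0" by (rule vec.linear_0[OF linear_left])

lemma skew: "\<mu> x y = - \<mu> y x"
proof -
  have "0 = \<mu> (x + y) (x + y)" by simp
  also have "\<dots> = \<mu> x y + \<mu> y x" by (simp only: add_left add_right) simp
  finally show ?thesis by (simp add: eq_neg_iff_add_eq_0)
qed

end

locale lie_algebra = alternating_map \<mu> for \<mu> :: "('n::finite) bracket" +
  assumes jacobi: "\<mu> x (\<mu> y z) + \<mu> y (\<mu> z x) + \<mu> z (\<mu> x y) = 0"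
begin

lemma leibniz: "\<mu> x (\<mu> y z) = \<mu> (\<mu> x y) z + \<mu> y (\<mu> x z)"
proof -
  have "\<mu> (\<mu> x y) z = - \<mu> z (\<mu> x y)" "\<mu> y (\<mu> x z) = - \<mu> y (\<mu> z x)"
    using skew[of "\<mu> x y" z] skew[of x z] by (simp_all add: neg_right)
  then show ?thesis using jacobi[of x y z] by (simp only:) (simp add: algebra_simps eq_neg_iff_add_eq_0)
qed

lemma killing_linear_left: "killing \<mu> (x + x') y = killing \<mu> x y + killing \<mu> x' y"
  "killing \<mu> (c *s x) y = c * killing \<mu> x y"
  by (simp_all add: killing_def add_left scale_left op_trace_add op_trace_scale)

lemma killing_linear_right: "killing \<mu> x (y + y') = killing \<mu> x y + killing \<mu> x y'"
  "killing \<mu> x (c *s y) = c * killing \<mu> x y"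
  by (simp_all add: killing_def add_left scale_left add_right scale_right op_trace_add op_trace_scale)

lemma killing_sym: "killing \<mu> x y = killing \<mu> y x"
  unfolding killing_def by (rule op_trace_commute[OF linear_right linear_right])

lemma killing_zero [simp]: "killing \<mu> 0 y = 0" "killing \<mu> x 0 = 0"
  by (simp_all add: killing_def op_trace_def)

lemma killing_sum_right: "killing \<mu> x (\<Sum>a\<in>S. f a) = (\<Sum>a\<in>S. killing \<mu> x (f a))"
  by (induction S rule: infinite_finite_induct) (simp_all add: killing_linear_right)

lemma killing_sum_left: "killing \<mu> (\<Sum>a\<in>S. f a) x = (\<Sum>a\<in>S. killing \<mu> (f a) x)"
  by (induction S rule: infinite_finite_induct) (simp_all add: killing_linear_left)

lemma killing_neg: "killing \<mu> (- x) y = - killing \<mu> x y" "killing \<mu> x (- y) = - killing \<mu> x y"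
  using killing_linear_left(2)[of "-1" x y] killing_linear_right(2)[of x "-1" y]
  by (simp_all del: vector_smult_lneg add: vector_sneg_minus1[symmetric])

text \<open>By Leibniz, \<open>ad\<close> of a bracket is a commutator; cyclicity of the trace then
  carries \<open>\<mu> y\<close> from the left end of one term to its right end.\<close>

lemma killing_invariant: "killing \<mu> (\<mu> x y) z = killing \<mu> x (\<mu> y z)"
proof -
  have lin: "clinear (\<lambda>v. \<mu> x (\<mu> z v))"
    by (rule clinearI) (simp_all add: add_right scale_right)
  have "killing \<mu> (\<mu> x y) z = op_trace (\<lambda>v. \<mu> x (\<mu> y (\<mu> z v))) - op_trace (\<lambda>v. \<mu> y (\<mu> x (\<mu> z v)))"
    unfolding killing_def by (simp add: leibniz[of x y "\<mu> z v" for v] flip: op_trace_diff)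
  also have "op_trace (\<lambda>v. \<mu> y (\<mu> x (\<mu> z v))) = op_trace (\<lambda>v. \<mu> x (\<mu> z (\<mu> y v)))"
    by (rule op_trace_commute[OF linear_right lin])
  also have "op_trace (\<lambda>v. \<mu> x (\<mu> y (\<mu> z v))) - \<dots> = killing \<mu> x (\<mu> y z)"
    unfolding killing_def
    by (simp add: leibniz[of y z v for v] add_right flip: op_trace_diff)
  finally show ?thesis .
qed

end

lemma lie_algebra_iff: "lie_algebra \<mu> \<longleftrightarrow> \<mu> \<in> lie_brackets"
  by (auto simp: lie_algebra_def alternating_map_def lie_algebra_axioms_def lie_brackets_def)

section \<open>The Casimir homotopy\<close>

text \<open>The Chevalley-Eilenberg differential of a 1-cochain with values in the adjoint module.
  Up to sign it is the infinitesimal action of \<open>A\<close> on \<open>\<mu>\<close>, so its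
  values are the tangent vectors of the orbit.\<close>

definition coboundary1 :: "('n::finite) bracket \<Rightarrow> (complex^'n \<Rightarrow> complex^'n) \<Rightarrow> 'n bracket" where
  "coboundary1 \<mu> A x y = \<mu> (A x) y + \<mu> x (A y) - A (\<mu> x y)"

text \<open>The part linear in \<open>f\<close> of the Jacobi expression of
  \<open>\<mu> + f\<close>; on alternating \<open>f\<close> it is the Chevalley-Eilenberg
  differential of a 2-cochain.\<close>

definition coboundary2 :: "('n::finite) bracket \<Rightarrow> 'n bracket \<Rightarrow> complex^'n \<Rightarrow> complex^'n \<Rightarrow> complex^'n \<Rightarrow> complex^'n" where
  "coboundary2 \<mu> f x y z = jacobiator \<mu> f x y z + jacobiator f \<mu> x y z"

context lie_algebra
begin

text \<open>The terms with \<open>A\<close> outermost cancel by \<open>A\<close> applied to the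
  Jacobi identity, those with \<open>A\<close> on a single argument by the Jacobi identity at
  \<open>A a, b, c\<close>, and those with \<open>A\<close> on an inner bracket cancel in
  pairs.\<close>

lemma coboundary2_coboundary1:
  assumes "clinear A"
  shows "coboundary2 \<mu> (coboundary1 \<mu> A) x y z = 0"
proof -
  have J: "A (\<mu> x (\<mu> y z)) = - A (\<mu> y (\<mu> z x)) - A (\<mu> z (\<mu> x y))"
    using arg_cong[OF jacobi[of x y z], of A]
    by (simp only: vec.linear_add[OF assms] vec.linear_0[OF assms]) (simp add: algebra_simps eq_neg_iff_add_eq_0)
  have c: "\<mu> (A a) (\<mu> b c) = - \<mu> b (\<mu> c (A a)) - \<mu> c (\<mu> (A a) b)" for a b c
    using jacobi[of "A a" b c] by (simp add: algebra_simps eq_neg_iff_add_eq_0)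
  show ?thesis
    unfolding coboundary2_def jacobiator_def coboundary1_def
    by (simp add: add_right diff_right J c[of x y z] c[of y z x] c[of z x y])
qed

end

definition killing_matrix :: "('n::finite) bracket \<Rightarrow> complex^'n^'n" where
  "killing_matrix \<mu> = (\<chi> i j. killing \<mu> (axis i 1) (axis j 1))"

locale killing_lie_algebra = lie_algebra \<mu> for \<mu> :: "('n::finite) bracket" +
  assumes nondegenerate: "killing_nondegenerate \<mu>"
begin

lemma killing_axis_eqI:
  assumes "\<And>i. killing \<mu> x (axis i 1) = killing \<mu> x' (axis i 1)"
  shows "x = x'"
proof -
  have "killing \<mu> (x - x') y = 0" for y
  proof -
    have "killing \<mu> (x - x') y = killing \<mu> (x + - x') (\<Sum>i\<in>UNIV. y $ i *s axis i 1)"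
      by (simp add: basis_expansion)
    also have "\<dots> = 0"
      by (simp only: killing_sum_right killing_linear_right killing_linear_left killing_neg) (simp add: assms)
    finally show ?thesis .
  qed
  then show ?thesis using nondegenerate unfolding killing_nondegenerate_def by (metis eq_iff_diff_eq_0)
qed

lemma invertible_killing_matrix: "invertible (killing_matrix \<mu>)"
proof -
  have "x = 0" if "killing_matrix \<mu> *v x = 0" for x
  proof (rule killing_axis_eqI)
    fix i
    have "killing \<mu> x (axis i 1) = killing \<mu> (axis i 1) (\<Sum>j\<in>UNIV. x $ j *s axis j 1)"
      by (simp add: basis_expansion killing_sym)
    also have "\<dots> = (killing_matrix \<mu> *v x) $ i"
      by (simp only: killing_sum_right killing_linear_right)
         (simp add: killing_matrix_def matrix_vector_mult_def mult.commute)
    finally show "killing \<mu> x (axis i 1) = killing \<mu> 0 (axis i 1)" using that by simp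
  qed
  then show ?thesis
    by (metis invertible_left_inverse matrix_left_invertible_ker)
qed

text \<open>The basis dual to the axes under the Killing form, whose Gram matrix is
  \<open>killing_matrix \<mu>\<close>.\<close>

definition dual :: "'n \<Rightarrow> complex^'n" where
  "dual i = matrix_inv (killing_matrix \<mu>) $ i"

lemma killing_dual: "killing \<mu> (dual i) (axis j 1) = (if i = j then 1 else 0)"
proof -
  have "killing \<mu> (dual i) (axis j 1) = killing \<mu> (\<Sum>k\<in>UNIV. dual i $ k *s axis k 1) (axis j 1)"
    by (simp add: basis_expansion)
  also have "\<dots> = (matrix_inv (killing_matrix \<mu>) ** killing_matrix \<mu>) $ i $ j"
    by (simp only: killing_sum_left killing_linear_left)
       (simp add: killing_matrix_def matrix_matrix_mult_def dual_def)
  also have "\<dots> = (if i = j then 1 else 0)"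
    using matrix_inv_mult(2)[OF invertible_killing_matrix] by (simp add: mat_def)
  finally show ?thesis .
qed

lemma killing_dual_component: "killing \<mu> (dual i) y = y $ i"
proof -
  have "killing \<mu> (dual i) y = killing \<mu> (dual i) (\<Sum>j\<in>UNIV. y $ j *s axis j 1)"
    by (simp add: basis_expansion)
  also have "\<dots> = y $ i"
    by (simp only: killing_sum_right killing_linear_right killing_dual)
       (simp add: if_distrib sum.delta cong: if_cong)
  finally show ?thesis .
qed

lemma expand_axis: "y = (\<Sum>j\<in>UNIV. killing \<mu> y (dual j) *s axis j 1)"
  by (subst killing_sym) (simp add: killing_dual_component basis_expansion)

lemma expand_dual: "y = (\<Sum>j\<in>UNIV. killing \<mu> y (axis j 1) *s dual j)"
  by (rule killing_axis_eqI)
     (simp add: killing_sum_left killing_linear_left killing_dual sum.delta if_distrib cong: if_cong)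

lemma op_trace_killing: "op_trace f = (\<Sum>i\<in>UNIV. killing \<mu> (dual i) (f (axis i 1)))"
  by (simp add: op_trace_def killing_dual_component)

text \<open>The tensor sum of \<open>axis i 1\<close> with \<open>dual i\<close> is invariant under
  the adjoint action, and \<open>F\<close> factors through the tensor product. In coordinates:
  \<open>ad x\<close> is skew for the Killing form, so its matrix in one basis is minus the
  transpose of its matrix in the dual basis.\<close>

lemma casimir_invariant:
  assumes F: "\<And>x. clinear (F x)" "\<And>y. clinear (\<lambda>x. F x y)"
  shows "(\<Sum>i\<in>UNIV. F (\<mu> x (axis i 1)) (dual i)) = - (\<Sum>i\<in>UNIV. F (axis i 1) (\<mu> x (dual i)))"
proof -
  have "(\<Sum>i\<in>UNIV. F (\<mu> x (axis i 1)) (dual i)) =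
      (\<Sum>i\<in>UNIV. \<Sum>j\<in>UNIV. killing \<mu> (\<mu> x (axis i 1)) (dual j) *s F (axis j 1) (dual i))"
    by (subst expand_axis) (simp only: vec.linear_sum[OF F(2)] vec.linear_scale[OF F(2)])
  also have "\<dots> = (\<Sum>j\<in>UNIV. \<Sum>i\<in>UNIV. - (killing \<mu> (\<mu> x (dual j)) (axis i 1) *s F (axis j 1) (dual i)))"
  proof (subst sum.swap, intro sum.cong refl)
    fix i j
    have "killing \<mu> (\<mu> x (axis i 1)) (dual j) = - killing \<mu> (\<mu> (axis i 1) x) (dual j)"
      by (subst skew) (rule killing_neg)
    also have "\<dots> = - killing \<mu> (\<mu> x (dual j)) (axis i 1)"
      by (simp only: killing_invariant[of "axis i 1"] killing_sym[of "axis i 1"])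
    finally show "killing \<mu> (\<mu> x (axis i 1)) (dual j) *s F (axis j 1) (dual i) =
        - (killing \<mu> (\<mu> x (dual j)) (axis i 1) *s F (axis j 1) (dual i))" by simp
  qed
  also have "\<dots> = - (\<Sum>j\<in>UNIV. F (axis j 1) (\<Sum>i\<in>UNIV. killing \<mu> (\<mu> x (dual j)) (axis i 1) *s dual i))"
    by (simp only: vec.linear_sum[OF F(1)] vec.linear_scale[OF F(1)] sum_negf)
  finally show ?thesis by (simp flip: expand_dual)
qed

text \<open>Paired with \<open>?y\<close>, the left side becomes the trace of \<open>ad z\<close>
  composed with \<open>ad ?y\<close>, which is the Killing form itself. Hence the eigenvalue of the
  Casimir element is exactly 1.\<close>

lemma casimir_identity: "(\<Sum>i\<in>UNIV. \<mu> (axis i 1) (\<mu> (dual i) z)) = z"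
proof (rule killing_axis_eqI)
  fix k
  let ?y = "axis k 1 :: complex^'n"
  have "killing \<mu> (\<mu> (axis i 1) (\<mu> (dual i) z)) ?y = killing \<mu> (dual i) (\<mu> z (\<mu> ?y (axis i 1)))" for i
  proof -
    have "killing \<mu> (\<mu> (axis i 1) (\<mu> (dual i) z)) ?y = - killing \<mu> (\<mu> (\<mu> (dual i) z) (axis i 1)) ?y"
      by (subst skew) (rule killing_neg)
    also have "\<dots> = - killing \<mu> (dual i) (\<mu> z (\<mu> (axis i 1) ?y))"
      by (simp only: killing_invariant)
    also have "\<dots> = killing \<mu> (dual i) (\<mu> z (\<mu> ?y (axis i 1)))"
      by (subst skew[of "axis i 1"]) (simp add: neg_right killing_neg)
    finally show ?thesis .
  qed
  then show "killing \<mu> (\<Sum>i\<in>UNIV. \<mu> (axis i 1) (\<mu> (dual i) z)) ?y = killing \<mu> z ?y"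
    by (simp add: killing_sum_left killing_def[of \<mu> z] op_trace_killing)
qed

text \<open>One half of the Casimir element is inserted into a cochain, the other half acts on its
  value. The model is Cartan's formula, by which insertion is a homotopy for the Lie
  derivative.\<close>

definition homotopy1 :: "'n bracket \<Rightarrow> complex^'n \<Rightarrow> complex^'n" where
  "homotopy1 f x = (\<Sum>i\<in>UNIV. \<mu> (axis i 1) (f (dual i) x))"

definition homotopy2 :: "(complex^'n \<Rightarrow> 'n bracket) \<Rightarrow> 'n bracket" where
  "homotopy2 h y z = (\<Sum>i\<in>UNIV. \<mu> (axis i 1) (h (dual i) y z))"

text \<open>Of the six terms of the contracted differential, the one with
  \<open>\<mu> (dual i) (f y z)\<close> gives \<open>f y z\<close> by the Casimir identity. In those
  with \<open>\<mu> a (f b (dual i))\<close> the two adjoint operators are interchanged; by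
  invariance the commutator cancels the term with \<open>f b (\<mu> a (dual i))\<close>. What
  remains is the coboundary.\<close>

lemma casimir_homotopy:
  assumes "f \<in> alternating_maps"
  shows "homotopy2 (coboundary2 \<mu> f) y z = f y z - coboundary1 \<mu> (homotopy1 f) y z"
proof -
  interpret f: alternating_map f by unfold_locales fact
  have inv1: "(\<Sum>i\<in>UNIV. \<mu> (\<mu> a (axis i 1)) (f b (dual i))) = - (\<Sum>i\<in>UNIV. \<mu> (axis i 1) (f b (\<mu> a (dual i))))" for a b
    by (rule casimir_invariant[where F = "\<lambda>u v. \<mu> u (f b v)"])
       (rule clinearI; simp add: add_left add_right f.add_right scale_left scale_right f.scale_right)+
  have m: "\<mu> (axis i 1) (\<mu> a w) = \<mu> a (\<mu> (axis i 1) w) - \<mu> (\<mu> a (axis i 1)) w" for i a w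
    by (simp add: leibniz[of a "axis i 1" w])
  have two: "(\<Sum>i\<in>UNIV. \<mu> (axis i 1) (\<mu> a (f b (dual i)))) =
      - \<mu> a (homotopy1 f b) + (\<Sum>i\<in>UNIV. \<mu> (axis i 1) (f b (\<mu> a (dual i))))" for a b
  proof -
    have "(\<Sum>i\<in>UNIV. \<mu> a (\<mu> (axis i 1) (f b (dual i)))) = - \<mu> a (homotopy1 f b)"
      unfolding homotopy1_def by (subst f.skew) (simp add: neg_right sum_right sum_negf)
    then show ?thesis
      by (simp add: m sum_subtractf inv1)
  qed
  have "homotopy2 (coboundary2 \<mu> f) y z =
      (\<Sum>i\<in>UNIV. \<mu> (axis i 1) (\<mu> (dual i) (f y z))) + (\<Sum>i\<in>UNIV. \<mu> (axis i 1) (\<mu> y (f z (dual i))))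
      - (\<Sum>i\<in>UNIV. \<mu> (axis i 1) (\<mu> z (f y (dual i)))) + (\<Sum>i\<in>UNIV. \<mu> (axis i 1) (f (dual i) (\<mu> y z)))
      + (\<Sum>i\<in>UNIV. \<mu> (axis i 1) (f y (\<mu> z (dual i)))) - (\<Sum>i\<in>UNIV. \<mu> (axis i 1) (f z (\<mu> y (dual i))))"
    unfolding homotopy2_def coboundary2_def jacobiator_def
    by (simp add: skew[of "dual _" y] f.skew[of "dual _" y] add_right diff_right neg_right f.neg_right
        sum.distrib sum_subtractf)
  also have "\<dots> = f y z - \<mu> y (homotopy1 f z) + \<mu> z (homotopy1 f y) + homotopy1 f (\<mu> y z)"
    unfolding casimir_identity two by (simp add: homotopy1_def)
  finally show ?thesis
    by (simp add: coboundary1_def skew[of z])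
qed

end

section \<open>Structure constants\<close>

abbreviation "sc \<equiv> structure_constants"
abbreviation "br \<equiv> bracket_of_constants"

lemma sc_nth: "sc f $ i $ j = f (axis i 1) (axis j 1)"
  by (simp add: structure_constants_def)

lemma br_add: "br (c + d) x y = br c x y + br d x y"
  by (simp add: bracket_of_constants_def vector_add_ldistrib sum.distrib)

lemma br_diff: "br (c - d) x y = br c x y - br d x y"
  by (simp add: bracket_of_constants_def vector_ssub_ldistrib sum_subtractf)

lemma br_scaleR: "br (r *\<^sub>R c) x y = r *\<^sub>R br c x y"
  by (simp add: bracket_of_constants_def scaleR_sum_right vec_eq_iff)

lemma br_zero [simp]: "br 0 x y = 0"
  by (simp add: bracket_of_constants_def)

lemma br_linear_right: "clinear (br c x)"
  by (rule clinearI)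
     (simp_all add: bracket_of_constants_def vec_eq_iff algebra_simps sum.distrib sum_distrib_left)

lemma br_linear_left: "clinear (\<lambda>x. br c x y)"
  by (rule clinearI)
     (simp_all add: bracket_of_constants_def vec_eq_iff algebra_simps sum.distrib sum_distrib_left)

lemmas br_simps = vec.linear_add[OF br_linear_right] vec.linear_add[OF br_linear_left]
  vec.linear_scale[OF br_linear_right] vec.linear_scale[OF br_linear_left]
  vec.linear_sum[OF br_linear_right] vec.linear_sum[OF br_linear_left]

lemma sum_axis: "(\<Sum>i\<in>UNIV. axis a (1::complex) $ i *s f i) = f a"
proof -
  have "(\<Sum>i\<in>UNIV. axis a (1::complex) $ i *s f i) = (\<Sum>i\<in>UNIV. if i = a then f i else 0)"
    by (rule sum.cong) (auto simp: axis_def)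
  then show ?thesis by simp
qed

lemma sc_br [simp]: "sc (br c) = c"
proof -
  have "br c (axis a 1) (axis b 1) = c $ a $ b" for a b
    by (simp only: bracket_of_constants_def vector_smult_assoc[symmetric] vec.scale_sum_right[symmetric] sum_axis)
  then show ?thesis by (simp add: structure_constants_def)
qed

lemma continuous_on_det:
  fixes f :: "'b::topological_space \<Rightarrow> 'a::{comm_ring_1,real_normed_algebra}^'n^'n"
  assumes "continuous_on S f"
  shows "continuous_on S (\<lambda>x. det (f x))"
  unfolding det_def by (intro continuous_intros assms)

text \<open>This and the next two maps treat one slot of the tensor each. Every one is bilinear in
  matrix and tensor, so continuity and the product rule apply directly. The source slots take
  \<open>g\<close> itself, not its inverse.\<close>

definition act_left :: "complex^'n^'n \<Rightarrow> complex^'n^'n^'n \<Rightarrow> complex^'n^'n^('n::finite)" where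
  "act_left g c = (\<chi> i j. g *v (c $ i $ j))"

definition act_first :: "complex^'n^'n^'n \<Rightarrow> complex^'n^'n \<Rightarrow> complex^'n^'n^('n::finite)" where
  "act_first c g = (\<chi> i j. \<Sum>k\<in>UNIV. g $ k $ i *s (c $ k $ j))"

definition act_second :: "complex^'n^'n^'n \<Rightarrow> complex^'n^'n \<Rightarrow> complex^'n^'n^('n::finite)" where
  "act_second c g = (\<chi> i j. \<Sum>k\<in>UNIV. g $ k $ j *s (c $ i $ k))"

lemma bounded_bilinear_act_left: "bounded_bilinear act_left"
  unfolding bilinear_conv_bounded_bilinear[symmetric] bilinear_def act_left_def
  by (auto intro!: linearI simp: vec_eq_iff matrix_vector_mult_def algebra_simps sum.distrib scaleR_sum_right)

lemma bounded_bilinear_act_first: "bounded_bilinear act_first"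
  unfolding bilinear_conv_bounded_bilinear[symmetric] bilinear_def act_first_def
  by (auto intro!: linearI simp: vec_eq_iff algebra_simps sum.distrib scaleR_sum_right)

lemma bounded_bilinear_act_second: "bounded_bilinear act_second"
  unfolding bilinear_conv_bounded_bilinear[symmetric] bilinear_def act_second_def
  by (auto intro!: linearI simp: vec_eq_iff algebra_simps sum.distrib scaleR_sum_right)

lemma act_left_one [simp]: "act_left (mat 1) c = c"
  by (simp add: act_left_def)

lemma act_first_one [simp]: "act_first c (mat 1) = (c :: complex^'n^'n^('n::finite))"
proof -
  have "mat 1 $ k $ i = axis i (1::complex) $ k" for i k :: 'n
    by (simp add: mat_def axis_def)
  then show ?thesis by (simp add: act_first_def sum_axis)
qed

lemma act_second_one [simp]: "act_second c (mat 1) = (c :: complex^'n^'n^('n::finite))"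
proof -
  have "mat 1 $ k $ i = axis i (1::complex) $ k" for i k :: 'n
    by (simp add: mat_def axis_def)
  then show ?thesis by (simp add: act_second_def sum_axis)
qed

lemma matrix_column: "g *v axis i 1 = (\<Sum>k\<in>UNIV. g $ k $ i *s axis k (1::complex))"
proof -
  have "g *v axis i 1 = (\<chi> k. g $ k $ i)"
    by (simp only: matrix_mult_sum sum_axis column_def)
  then show ?thesis using basis_expansion[of "\<chi> k. g $ k $ i"] by simp
qed

lemma br_axis: "br c (axis i 1) (axis j 1) = c $ i $ j"
  by (metis sc_br sc_nth)

lemma act_first_br: "act_first c g = sc (\<lambda>x y. br c (g *v x) y)"
  by (simp add: structure_constants_def act_first_def matrix_column br_simps br_axis)

lemma act_second_br: "act_second c g = sc (\<lambda>x y. br c x (g *v y))"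
  by (simp add: structure_constants_def act_second_def matrix_column br_simps br_axis)

lemma br_sc:
  assumes "\<And>x. clinear (f x)" "\<And>y. clinear (\<lambda>x. f x y)"
  shows "br (sc f) = f"
proof (intro ext)
  fix x y
  have "f x y = (\<Sum>i\<in>UNIV. x $ i *s f (axis i 1) y)"
    by (rule clinear_basis[OF assms(2)])
  also have "\<dots> = (\<Sum>i\<in>UNIV. x $ i *s (\<Sum>j\<in>UNIV. y $ j *s f (axis i 1) (axis j 1)))"
    by (rule sum.cong[OF refl], rule arg_cong, rule clinear_basis[OF assms(1)])
  finally show "br (sc f) x y = f x y"
    by (simp add: bracket_of_constants_def structure_constants_def vec.scale_sum_right)
qed


lemma br_act_first_second: "br (act_second (act_first c g) g) x y = br c (g *v x) (g *v y)"
proof -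
  have 1: "br (act_first c g) = (\<lambda>x y. br c (g *v x) y)"
    unfolding act_first_br
    by (rule br_sc) (rule clinearI; simp only: br_simps matrix_vector_right_distrib vector_scalar_commute)+
  have "br (act_second (act_first c g) g) = (\<lambda>x y. br c (g *v x) (g *v y))"
    unfolding act_second_br 1
    by (rule br_sc) (rule clinearI; simp only: br_simps matrix_vector_right_distrib vector_scalar_commute)+
  then show ?thesis by simp
qed

lemma br_act_left: "br (act_left g c) x y = g *v br c x y"
proof -
  have "act_left g c = sc (\<lambda>x y. g *v br c x y)"
    by (simp add: act_left_def structure_constants_def br_axis)
  moreover have "br (sc (\<lambda>x y. g *v br c x y)) = (\<lambda>x y. g *v br c x y)"
    by (rule br_sc) (rule clinearI; simp only: br_simps matrix_vector_right_distrib vector_scalar_commute)+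
  ultimately show ?thesis by simp
qed

section \<open>Rigidity\<close>

lemma coboundary2_diff:
  assumes "\<And>x. clinear (\<mu> x)"
  shows "coboundary2 \<mu> (\<lambda>x y. f x y - g x y) x y z = coboundary2 \<mu> f x y z - coboundary2 \<mu> g x y z"
  by (simp add: coboundary2_def jacobiator_def vec.linear_diff[OF assms])

context alternating_map
begin

lemma clinear_coboundary1:
  assumes "clinear A"
  shows "clinear (coboundary1 \<mu> A x)" "clinear (\<lambda>x. coboundary1 \<mu> A x y)"
  by (rule clinearI; simp add: coboundary1_def add_left add_right scale_left scale_right
      vec.linear_add[OF assms] vec.linear_scale[OF assms] algebra_simps vec_eq_iff)+

lemma coboundary1_alternating:
  assumes "clinear A"
  shows "coboundary1 \<mu> A \<in> alternating_maps"
proof -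
  have "coboundary1 \<mu> A x x = 0" for x
    using skew[of "A x" x] by (simp add: coboundary1_def vec.linear_0[OF assms])
  then show ?thesis
    using clinear_coboundary1[OF assms] by (auto simp: alternating_maps_def)
qed

lemma scaleR_right: "\<mu> x (r *\<^sub>R y) = r *\<^sub>R \<mu> x y"
  using scale_right[of x "of_real r" y] by (simp add: vector_scalar_mult_def scaleR_vec_def scaleR_conv_of_real)

lemma br_sc_self: "br (sc \<mu>) = \<mu>"
  by (rule alternating_maps_expand[OF alternating])

end

context killing_lie_algebra
begin

lemma clinear_homotopy1:
  assumes "\<And>x. clinear (f x)"
  shows "clinear (homotopy1 f)"
  by (rule clinearI) (simp_all add: homotopy1_def vec.linear_add[OF assms] vec.linear_scale[OF assms]
      add_right scale_right sum.distrib vec.scale_sum_right)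

definition homotopy_matrix :: "complex^'n^'n^'n \<Rightarrow> complex^'n^'n" where
  "homotopy_matrix c = matrix (homotopy1 (br c))"

lemma homotopy_matrix_apply: "homotopy_matrix c *v x = homotopy1 (br c) x"
  unfolding homotopy_matrix_def by (rule matrix_works[OF clinear_homotopy1[OF br_linear_right]])

text \<open>\<open>coboundary1\<close> in coordinates, assembled from the slot actions so that, up
  to sign, it appears literally as the derivative of \<open>defect\<close> in the matrix
  direction.\<close>

definition coboundary_constants :: "complex^'n^'n \<Rightarrow> complex^'n^'n^'n" where
  "coboundary_constants A = act_first (sc \<mu>) A + act_second (sc \<mu>) A - act_left A (sc \<mu>)"

lemma br_coboundary_constants: "br (coboundary_constants A) = coboundary1 \<mu> ((*v) A)"
proof -
  have "coboundary_constants A = sc (coboundary1 \<mu> ((*v) A))"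
    unfolding coboundary_constants_def act_first_br act_second_br br_sc_self
    by (simp add: coboundary1_def act_left_def structure_constants_def vec_eq_iff)
  then show ?thesis
    using alternating_maps_expand[OF coboundary1_alternating[of "(*v) A"]]
    by (simp add: vec.linear_axioms)
qed

text \<open>The range of \<open>slice\<close> is a complement to the image of \<open>coboundary1\<close>, that is, to the tangent
  space of the orbit.\<close>

definition slice :: "complex^'n^'n^'n \<Rightarrow> complex^'n^'n^'n" where
  "slice c = c - coboundary_constants (homotopy_matrix c)"

lemma bounded_linear_homotopy_matrix: "bounded_linear homotopy_matrix"
proof -
  have "linear homotopy_matrix"
    by (rule linearI; simp add: vec_eq_iff homotopy_matrix_def matrix_def homotopy1_def br_add br_scaleR
       add_right sum.distrib scaleR_sum_right scaleR_right)
  then show ?thesis by (simp add: linear_conv_bounded_linear)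
qed

lemma bounded_linear_slice: "bounded_linear slice"
  unfolding slice_def coboundary_constants_def
  by (intro bounded_linear_sub bounded_linear_add bounded_linear_ident
      bounded_linear_compose[OF bounded_bilinear.bounded_linear_right[OF bounded_bilinear_act_first] bounded_linear_homotopy_matrix]
      bounded_linear_compose[OF bounded_bilinear.bounded_linear_right[OF bounded_bilinear_act_second] bounded_linear_homotopy_matrix]
      bounded_linear_compose[OF bounded_bilinear.bounded_linear_left[OF bounded_bilinear_act_left] bounded_linear_homotopy_matrix])

lemma br_slice: "br (slice v) x y = br v x y - coboundary1 \<mu> (homotopy1 (br v)) x y"
proof -
  have "(*v) (homotopy_matrix v) = homotopy1 (br v)"
    by (rule ext) (rule homotopy_matrix_apply)
  then show ?thesis
    by (simp add: slice_def br_diff br_coboundary_constants)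
qed

text \<open>A zero of the second component at \<open>(A, v, u)\<close> says that \<open>1 + A\<close> carries the bracket \<open>u\<close> to
  \<open>\<mu> + slice v\<close>; writing this without \<open>(1 + A)\<^sup>-\<^sup>1\<close> keeps the map polynomial.\<close>

definition defect :: "(complex^'n^'n) \<times> (complex^'n^'n^'n) \<times> (complex^'n^'n^'n) \<Rightarrow> (complex^'n^'n^'n) \<times> (complex^'n^'n^'n)" where
  "defect p = (snd (snd p), act_left (mat 1 + fst p) (snd (snd p))
     - act_second (act_first (sc \<mu> + slice (fst (snd p))) (mat 1 + fst p)) (mat 1 + fst p))"

definition defect_derivative :: "(complex^'n^'n) \<times> (complex^'n^'n^'n) \<times> (complex^'n^'n^'n) \<Rightarrow> (complex^'n^'n^'n) \<times> (complex^'n^'n^'n)" where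
  "defect_derivative h = (snd (snd h), snd (snd h) - coboundary_constants (fst h) - slice (fst (snd h)))"

lemma has_derivative_defect: "(defect has_derivative defect_derivative) (at (0, 0, sc \<mu>))"
proof -
  let ?F = "at (0, 0, sc \<mu>) :: ((complex^'n^'n) \<times> (complex^'n^'n^'n) \<times> (complex^'n^'n^'n)) filter"
  have d1: "((\<lambda>p. mat 1 + fst p) has_derivative fst) ?F"
    by (auto intro!: derivative_eq_intros)
  have d2: "((\<lambda>p. snd (snd p)) has_derivative (\<lambda>h. snd (snd h))) ?F"
    by (auto intro!: derivative_eq_intros)
  have d3: "((\<lambda>p. sc \<mu> + slice (fst (snd p))) has_derivative (\<lambda>h. slice (fst (snd h)))) ?F"
    by (auto intro!: derivative_eq_intros bounded_linear.has_derivative[OF bounded_linear_slice])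
  note d4 = bounded_bilinear.FDERIV[OF bounded_bilinear_act_first d3 d1]
  note d5 = bounded_bilinear.FDERIV[OF bounded_bilinear_act_second d4 d1]
  note d6 = bounded_bilinear.FDERIV[OF bounded_bilinear_act_left d1 d2]
  have [simp]: "slice 0 = 0"
    by (rule linear_0[OF bounded_linear.linear[OF bounded_linear_slice]])
  have [simp]: "act_second (a + b) c = act_second a c + act_second b c" for a b c :: "_ ^'n"
    by (rule bounded_bilinear.add_left[OF bounded_bilinear_act_second])
  show ?thesis
    unfolding defect_def
    by (rule has_derivative_eq_rhs[OF has_derivative_Pair[OF d2 has_derivative_diff[OF d6 d5]]])
       (auto simp: defect_derivative_def coboundary_constants_def fun_eq_iff)
qed

text \<open>By the very definition of \<open>slice\<close>, every \<open>c\<close> equals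
  \<open>coboundary_constants (homotopy_matrix c) + slice c\<close>; this is used for
  \<open>c = fst p - snd p\<close>. The parameter \<open>v\<close> is redundant, so the derivative
  is not injective in general, but the open mapping theorem asks only for a right inverse.\<close>

lemma defect_derivative_surjective:
  "\<exists>g'. bounded_linear g' \<and> defect_derivative \<circ> g' = id"
proof -
  let ?g = "\<lambda>p. (- homotopy_matrix (snd p - fst p), - (snd p - fst p), fst p)"
  have h: "homotopy_matrix (- c) = - homotopy_matrix c" for c
    by (rule linear_neg[OF bounded_linear.linear[OF bounded_linear_homotopy_matrix]])
  have s: "slice (- c) = - slice c" for c
    by (rule linear_neg[OF bounded_linear.linear[OF bounded_linear_slice]])
  have c: "coboundary_constants (- A) = - coboundary_constants A" for A
    by (simp add: coboundary_constants_def bounded_bilinear.minus_right[OF bounded_bilinear_act_first]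
      bounded_bilinear.minus_right[OF bounded_bilinear_act_second]
      bounded_bilinear.minus_left[OF bounded_bilinear_act_left])
  have "bounded_linear ?g"
    by (intro bounded_linear_Pair bounded_linear_minus bounded_linear_sub bounded_linear_fst bounded_linear_snd
        bounded_linear_compose[OF bounded_linear_homotopy_matrix])
  moreover have "defect_derivative \<circ> ?g = id"
    by (simp only: fun_eq_iff o_def defect_derivative_def fst_conv snd_conv s c) (simp add: slice_def)
  ultimately show ?thesis by blast
qed

lemma continuous_on_defect: "continuous_on S defect"
  unfolding defect_def
  by (intro continuous_intros bounded_bilinear.continuous_on[OF bounded_bilinear_act_first]
      bounded_bilinear.continuous_on[OF bounded_bilinear_act_second]
      bounded_bilinear.continuous_on[OF bounded_bilinear_act_left]
      bounded_linear.continuous_on[OF bounded_linear_slice])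

text \<open>The bilinear map behind the equation \<open>w = - k J(w, w)\<close> for the transverse
  part; its bound is the constant \<open>K\<close> in \<open>rigidity\<close>.\<close>

definition quadratic_part :: "complex^'n^'n^'n \<Rightarrow> complex^'n^'n^'n \<Rightarrow> complex^'n^'n^'n" where
  "quadratic_part c d = sc (homotopy2 (jacobiator (br c) (br d)))"

lemma bounded_bilinear_quadratic_part: "bounded_bilinear quadratic_part"
proof -
  have [simp]: "br c x (r *\<^sub>R y) = r *\<^sub>R br c x y" for c x y and r :: real
    using vec.linear_scale[OF br_linear_right[of c x], of "of_real r" y]
    by (simp add: vector_scalar_mult_def scaleR_vec_def scaleR_conv_of_real)
  show ?thesis
    unfolding bilinear_conv_bounded_bilinear[symmetric] bilinear_def
    by (safe intro!: linearI; simp add: quadratic_part_def vec_eq_iff sc_nth homotopy2_def jacobiator_def br_add br_scaleR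
        br_simps add_right sum.distrib scaleR_right scaleR_sum_right
        scaleR_right_distrib)
qed

text \<open>\<open>slice v = v - d k v\<close> has the same differential as \<open>v\<close>,
  because \<open>d d = 0\<close>, and \<open>k d v = v - d k v\<close> is the homotopy formula. That
  formula asks for \<open>v\<close> to be alternating, which it is because \<open>slice v\<close>
  and the coboundary are.\<close>

lemma slice_fixed_point:
  assumes w: "br (slice v) \<in> alternating_maps"
  shows "homotopy2 (coboundary2 \<mu> (br (slice v))) y z = br (slice v) y z"
proof -
  let ?h = "homotopy1 (br v)"
  have lin: "clinear ?h" by (rule clinear_homotopy1[OF br_linear_right])
  have "br v \<in> alternating_maps"
  proof -
    have "br v x x = 0" for x
    proof -
      have "br v x x = br (slice v) x x + coboundary1 \<mu> ?h x x" by (simp add: br_slice)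
      then show ?thesis
        using w coboundary1_alternating[OF lin] by (simp add: alternating_maps_def)
    qed
    then show ?thesis using br_linear_right br_linear_left by (auto simp: alternating_maps_def)
  qed
  note homotopy = casimir_homotopy[OF this]
  have "coboundary2 \<mu> (br (slice v)) = coboundary2 \<mu> (br v)"
  proof (intro ext)
    fix a b c
    have "br (slice v) = (\<lambda>x y. br v x y - coboundary1 \<mu> ?h x y)" by (simp add: br_slice fun_eq_iff)
    then show "coboundary2 \<mu> (br (slice v)) a b c = coboundary2 \<mu> (br v) a b c"
      by (simp add: coboundary2_diff[OF linear_right] coboundary2_coboundary1[OF lin])
  qed
  then show ?thesis by (simp add: homotopy br_slice)
qed

text \<open>Open mapping moves each nearby \<open>\<nu>\<close> to \<open>\<mu> + w\<close> with
  \<open>w\<close> in the slice. The Jacobi identity of \<open>\<nu>\<close> then bounds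
  \<open>norm w\<close> by \<open>K\<close> times its square, and smallness gives
  \<open>w = 0\<close>. The set \<open>G\<close> allows \<open>g\<close> to be kept near the
  identity.\<close>

theorem rigidity:
  assumes G: "open G" "mat 1 \<in> G"
  shows "\<exists>d>0. \<forall>\<nu>\<in>lie_brackets. dist (sc \<nu>) (sc \<mu>) < d \<longrightarrow>
    (\<exists>g\<in>G. invertible g \<and> (\<forall>x y. g *v \<nu> x y = \<mu> (g *v x) (g *v y)))"
proof -
  obtain K where K: "K > 0" "\<And>c d. norm (quadratic_part c d) \<le> norm c * norm d * K"
    using bounded_bilinear.pos_bounded[OF bounded_bilinear_quadratic_part] by metis
  \<comment> \<open>\<open>1 / K\<close> is the threshold below which the quadratic estimate forces
    the transverse part to vanish.\<close>
  define T where "T = {p :: (complex^'n^'n) \<times> (complex^'n^'n^'n) \<times> (complex^'n^'n^'n).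
    mat 1 + fst p \<in> G \<and> det (mat 1 + fst p) \<noteq> 0 \<and> norm (slice (fst (snd p))) < 1 / K}"
  have "open T"
    unfolding T_def
  proof (intro open_Collect_conj)
    have "open ((\<lambda>p :: (complex^'n^'n) \<times> (complex^'n^'n^'n) \<times> (complex^'n^'n^'n). mat 1 + fst p) -` G)"
      by (intro open_vimage G continuous_intros)
    then show "open {p :: (complex^'n^'n) \<times> (complex^'n^'n^'n) \<times> (complex^'n^'n^'n). mat 1 + fst p \<in> G}"
      by (simp add: vimage_def)
    show "open {p :: (complex^'n^'n) \<times> (complex^'n^'n^'n) \<times> (complex^'n^'n^'n). det (mat 1 + fst p) \<noteq> 0}"
      by (intro open_Collect_neq continuous_on_det continuous_intros)
    show "open {p :: (complex^'n^'n) \<times> (complex^'n^'n^'n) \<times> (complex^'n^'n^'n). norm (slice (fst (snd p))) < 1 / K}"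
      by (intro open_Collect_less continuous_intros bounded_linear.continuous_on[OF bounded_linear_slice])
  qed
  moreover have slice0: "slice 0 = 0"
    by (rule linear_0[OF bounded_linear.linear[OF bounded_linear_slice]])
  then have "(0, 0, sc \<mu>) \<in> T"
    using G K by (simp add: T_def)
  ultimately have "(0, 0, sc \<mu>) \<in> interior T" by (simp add: interior_open)
  moreover obtain g' where "bounded_linear g'" "defect_derivative \<circ> g' = id"
    using defect_derivative_surjective by blast
  \<comment> \<open>This open mapping theorem asks for the derivative at the base point only,
    together with continuity elsewhere.\<close>
  ultimately have "defect (0, 0, sc \<mu>) \<in> interior (defect ` T)"
    using sussmann_open_mapping[OF open_UNIV continuous_on_defect UNIV_I has_derivative_defect _ _ subset_UNIV] by blast
  then have "(sc \<mu>, 0) \<in> interior (defect ` T)"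
    by (simp add: defect_def slice0)
  then obtain d where d: "d > 0" "ball (sc \<mu>, 0) d \<subseteq> defect ` T"
    by (auto simp: mem_interior)
  have "\<exists>g\<in>G. invertible g \<and> (\<forall>x y. g *v \<nu> x y = \<mu> (g *v x) (g *v y))"
    if \<nu>: "\<nu> \<in> lie_brackets" and "dist (sc \<nu>) (sc \<mu>) < d" for \<nu>
  proof -
    interpret \<nu>: lie_algebra \<nu> using \<nu> by (simp add: lie_algebra_iff)
    have "(sc \<nu>, 0) \<in> ball (sc \<mu>, 0) d"
      using that(2) by (simp add: dist_Pair_Pair dist_commute)
    then obtain A v where T: "(A, v, sc \<nu>) \<in> T" and
      eq: "act_left (mat 1 + A) (sc \<nu>) = act_second (act_first (sc \<mu> + slice v) (mat 1 + A)) (mat 1 + A)"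
      using d(2) by (force simp: defect_def)
    define g where "g = mat 1 + A"
    have gG: "g \<in> G" and inv: "invertible g" and small: "norm (slice v) < 1 / K"
      using T by (auto simp: T_def g_def invertible_det_nz)
    define w where "w = br (slice v)"
    have g\<nu>: "g *v \<nu> x y = \<mu> (g *v x) (g *v y) + w (g *v x) (g *v y)" for x y
    proof -
      have "g *v \<nu> x y = br (act_left g (sc \<nu>)) x y"
        by (simp add: br_act_left \<nu>.br_sc_self)
      then show ?thesis
        unfolding eq[folded g_def] br_act_first_second by (simp add: br_add br_sc_self w_def)
    qed
    have surj: "\<exists>x'. x = g *v x'" for x
      using matrix_inv_mult(1)[OF inv] by (metis matrix_vector_mul_assoc matrix_vector_mul_lid)
    have "w x x = 0" for x
    proof -
      obtain x' where "x = g *v x'" using surj by blast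
      then show ?thesis using g\<nu>[of x' x'] by simp
    qed
    then have w_alt: "w \<in> alternating_maps"
      using br_linear_right br_linear_left by (auto simp: alternating_maps_def w_def)
    \<comment> \<open>The Maurer-Cartan equation: pushed forward by \<open>g\<close>, the Jacobi
      identity of \<open>\<nu>\<close> becomes that of \<open>\<mu> + w\<close>, and the part in
      \<open>\<mu>\<close> alone vanishes.\<close>
    have J: "coboundary2 \<mu> w x y z = - jacobiator w w x y z" for x y z
    proof -
      obtain x' y' z' where [simp]: "x = g *v x'" "y = g *v y'" "z = g *v z'" using surj by metis
      have "g *v (\<nu> x' (\<nu> y' z') + \<nu> y' (\<nu> z' x') + \<nu> z' (\<nu> x' y')) =
          coboundary2 \<mu> w x y z + jacobiator w w x y z + jacobiator \<mu> \<mu> x y z"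
        unfolding matrix_vector_right_distrib g\<nu> jacobiator_def coboundary2_def w_def
        by (simp add: br_simps add_right)
      moreover have "jacobiator \<mu> \<mu> x y z = 0"
        by (simp only: jacobiator_def jacobi)
      ultimately have "coboundary2 \<mu> w x y z + jacobiator w w x y z = 0"
        by (simp only: \<nu>.jacobi matrix_vector_mult_0_right add_0_right)
      then show ?thesis by (simp only: eq_neg_iff_add_eq_0)
    qed
    have "slice v = - quadratic_part (slice v) (slice v)"
    proof -
      have "w y z = - homotopy2 (jacobiator w w) y z" for y z
        using slice_fixed_point[of v y z] w_alt J
        by (simp add: w_def homotopy2_def neg_right sum_negf)
      then have "sc w = - sc (homotopy2 (jacobiator w w))"
        by (simp add: structure_constants_def vec_eq_iff)
      then show ?thesis by (simp add: w_def quadratic_part_def)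
    qed
    then have "norm (slice v) \<le> norm (slice v) * norm (slice v) * K"
      using K(2)[of "slice v" "slice v"] by (metis norm_minus_cancel)
    moreover have "norm (slice v) * (norm (slice v) * K) < norm (slice v) * 1" if "norm (slice v) \<noteq> 0"
      using small K(1) that by (intro mult_strict_left_mono) (auto simp: field_simps)
    ultimately have "slice v = 0" by fastforce
    then have "w x y = 0" for x y by (simp add: w_def)
    then show ?thesis using gG inv g\<nu> by auto
  qed
  then show ?thesis using d(1) by blast
qed

end

section \<open>Generalized eigenspaces\<close>

locale complex_operator =
  fixes A :: "complex^'n \<Rightarrow> complex^('n::finite)"
  assumes linear: "clinear A"
begin

definition shift :: "complex \<Rightarrow> complex^'n \<Rightarrow> complex^'n" where
  "shift a u = A u - a *s u"

definition gen_eigenspace :: "complex \<Rightarrow> (complex^'n) set" where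
  "gen_eigenspace a = {v. \<exists>m. (shift a ^^ m) v = 0}"

lemma linear_shift: "clinear (shift a)"
  by (rule clinearI) (simp_all add: shift_def vec.linear_add[OF linear] vec.linear_scale[OF linear] vec_eq_iff algebra_simps)

lemmas shift_simps = vec.linear_add[OF linear_shift] vec.linear_scale[OF linear_shift]
  vec.linear_diff[OF linear_shift] vec.linear_0[OF linear_shift]

lemma linear_shift_funpow: "clinear (shift a ^^ m)"
proof (induction m)
  case 0
  then show ?case by (auto intro!: clinearI)
next
  case (Suc m)
  show ?case
    by (rule clinearI) (simp_all add: vec.linear_add[OF Suc] vec.linear_scale[OF Suc] shift_simps)
qed

lemma shift_funpow_zero_mono:
  assumes "(shift a ^^ m) v = 0" "m \<le> k"
  shows "(shift a ^^ k) v = 0"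
  using assms(2,1) by (induction rule: dec_induct) (simp_all add: shift_simps)

lemma subspace_gen_eigenspace: "vec.subspace (gen_eigenspace a)"
  unfolding vec.subspace_def
proof (intro conjI ballI allI)
  show "0 \<in> gen_eigenspace a"
    using vec.linear_0[OF linear_shift_funpow] by (auto simp: gen_eigenspace_def)
  fix v assume "v \<in> gen_eigenspace a"
  then obtain m where m: "(shift a ^^ m) v = 0" by (auto simp: gen_eigenspace_def)
  show "c *s v \<in> gen_eigenspace a" for c
    using m vec.linear_scale[OF linear_shift_funpow, of m a c v] by (auto simp: gen_eigenspace_def)
  fix w assume "w \<in> gen_eigenspace a"
  then obtain k where k: "(shift a ^^ k) w = 0" by (auto simp: gen_eigenspace_def)
  have "(shift a ^^ max m k) (v + w) = 0"
    using shift_funpow_zero_mono[OF m] shift_funpow_zero_mono[OF k]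
    by (simp add: vec.linear_add[OF linear_shift_funpow])
  then show "v + w \<in> gen_eigenspace a" by (auto simp: gen_eigenspace_def)
qed

lemma gen_eigenspace_shiftD:
  assumes "shift a v \<in> gen_eigenspace a"
  shows "v \<in> gen_eigenspace a"
proof -
  obtain m where "(shift a ^^ m) (shift a v) = 0" using assms by (auto simp: gen_eigenspace_def)
  then have "(shift a ^^ Suc m) v = 0" by (simp only: funpow_Suc_right o_def)
  then show ?thesis unfolding gen_eigenspace_def by blast
qed

lemma shift_gen_eigenspace_self:
  assumes "v \<in> gen_eigenspace a"
  shows "shift a v \<in> gen_eigenspace a"
proof -
  obtain m where "(shift a ^^ m) v = 0" using assms by (auto simp: gen_eigenspace_def)
  then have "(shift a ^^ Suc m) v = 0" by (simp add: shift_simps)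
  then have "(shift a ^^ m) (shift a v) = 0" by (simp only: funpow_Suc_right o_def)
  then show ?thesis unfolding gen_eigenspace_def by blast
qed

lemma shift_change: "shift b v = shift a v + (a - b) *s v"
  by (simp add: shift_def vec_eq_iff algebra_simps)

lemma shift_gen_eigenspace:
  assumes "v \<in> gen_eigenspace a"
  shows "shift b v \<in> gen_eigenspace a"
  unfolding shift_change[of b v a]
  by (intro vec.subspace_add vec.subspace_scale subspace_gen_eigenspace shift_gen_eigenspace_self assms)

lemma shift_funpow_gen_eigenspace:
  assumes "v \<in> gen_eigenspace a"
  shows "(shift b ^^ m) v \<in> gen_eigenspace a"
  by (induction m) (simp_all add: assms shift_gen_eigenspace)

text \<open>On the generalized eigenspace of \<open>b\<close>, \<open>shift a\<close> is the nonzero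
  scalar \<open>b - a\<close> plus the nilpotent \<open>shift b\<close>. Induction on the nilpotency
  exponent plays the part of a Neumann series: solve for \<open>shift b u\<close> first, then
  correct \<open>u\<close> by the result.\<close>

lemma shift_solve:
  assumes "u \<in> gen_eigenspace b" "a \<noteq> b"
  shows "\<exists>z\<in>gen_eigenspace b. shift a z = u"
proof -
  obtain m where "(shift b ^^ m) u = 0" using assms by (auto simp: gen_eigenspace_def)
  then show ?thesis using assms(1)
  proof (induction m arbitrary: u)
    case 0
    then show ?case using shift_simps(4) by (intro bexI[of _ 0]) auto
  next
    case (Suc m)
    have "(shift b ^^ m) (shift b u) = 0" using Suc.prems(1) by (simp only: funpow_Suc_right o_def)
    then obtain z where z: "z \<in> gen_eigenspace b" "shift a z = shift b u"
      using Suc.IH shift_gen_eigenspace_self[OF Suc.prems(2)] by blast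
    define z' where "z' = (1 / (b - a)) *s (u - z)"
    have "shift a z' = (1 / (b - a)) *s (shift a u - shift b u)"
      by (simp add: z'_def shift_simps z(2))
    also have "\<dots> = u" using assms(2) by (simp only: shift_change[of a u b] add_diff_cancel_left' vector_smult_assoc) simp
    finally have "shift a z' = u" .
    moreover have "z' \<in> gen_eigenspace b"
      unfolding z'_def
      by (intro vec.subspace_diff vec.subspace_scale subspace_gen_eigenspace z Suc.prems(2))
    ultimately show ?case by blast
  qed
qed

lemma shift_inj:
  assumes "v \<in> gen_eigenspace b" "a \<noteq> b" "shift a v = 0"
  shows "v = 0"
proof -
  obtain m where m: "(shift b ^^ m) v = 0" using assms by (auto simp: gen_eigenspace_def)
  have "shift b v = (a - b) *s v" using assms(3) by (simp add: shift_change[of b v a])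
  then have "(shift b ^^ k) v = (a - b) ^ k *s v" for k
    by (induction k) (simp_all only: funpow.simps o_def id_apply power_0 power_Suc shift_simps vector_smult_assoc
        mult.commute vector_smult_lid)
  then show ?thesis using m assms(2) by (metis vec.scale_eq_0_iff eq_iff_diff_eq_0 power_eq_0_iff)
qed

lemma shift_funpow_inj:
  assumes "v \<in> gen_eigenspace b" "a \<noteq> b" "(shift a ^^ m) v = 0"
  shows "v = 0"
  using assms(3)
proof (induction m)
  case (Suc m)
  then show ?case using shift_inj[OF shift_funpow_gen_eigenspace[OF assms(1)] assms(2)] by simp
qed simp

text \<open>A power of \<open>shift a0\<close> kills the summand at \<open>a0\<close>, keeps the
  others in their own spaces and is injective there.\<close>

lemma gen_eigenspaces_independent:
  assumes "finite F" "\<And>a. a \<in> F \<Longrightarrow> u a \<in> gen_eigenspace a" "(\<Sum>a\<in>F. u a) = 0" "a \<in> F"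
  shows "u a = 0"
  using assms
proof (induction F arbitrary: u a rule: finite_induct)
  case (insert a0 F)
  obtain m where m: "(shift a0 ^^ m) (u a0) = 0" using insert.prems(1)[of a0] by (auto simp: gen_eigenspace_def)
  have "(shift a0 ^^ m) (u a0 + (\<Sum>a\<in>F. u a)) = 0"
    using insert by (simp add: vec.linear_0[OF linear_shift_funpow])
  then have "(\<Sum>a\<in>F. (shift a0 ^^ m) (u a)) = 0"
    by (simp add: vec.linear_add[OF linear_shift_funpow] vec.linear_sum[OF linear_shift_funpow] m)
  then have "(shift a0 ^^ m) (u b) = 0" if "b \<in> F" for b
    by (rule insert.IH[rotated 1]) (use insert.prems(1) that in \<open>auto intro: shift_funpow_gen_eigenspace\<close>)
  then have F: "u b = 0" if "b \<in> F" for b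
    using shift_funpow_inj[of "u b" b a0 m] insert.prems(1) insert.hyps that by blast
  then have "(\<Sum>a\<in>F. u a) = 0" by simp
  then have "u a0 = 0" using insert by simp
  then show ?case using F insert.prems by auto
qed simp

text \<open>Since \<open>shift a\<close> is onto on every other generalized eigenspace, each vector
  of the span is \<open>shift a z\<close> up to an element of \<open>gen_eigenspace a\<close>, with
  \<open>z\<close> in the span. Then \<open>shift a\<close> sends \<open>w - z\<close> into
  \<open>gen_eigenspace a\<close>, so \<open>w - z\<close> lies there itself.\<close>

lemma span_shiftD:
  assumes "shift a w \<in> vec.span (\<Union>(range gen_eigenspace))"
  shows "w \<in> vec.span (\<Union>(range gen_eigenspace))"
proof -
  let ?S = "vec.span (\<Union>(range gen_eigenspace))"
  have "\<exists>z\<in>?S. \<exists>y\<in>gen_eigenspace a. shift a w = shift a z + y"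
    using assms
  proof (induction rule: vec.span_induct_alt)
    case base
    show ?case
      by (intro bexI[of _ 0] vec.span_zero vec.subspace_0[OF subspace_gen_eigenspace]) (simp add: shift_simps)
  next
    case (step c x v)
    obtain z y where zy: "z \<in> ?S" "y \<in> gen_eigenspace a" "v = shift a z + y" using step by blast
    obtain b where b: "x \<in> gen_eigenspace b" using step by auto
    show ?case
    proof (cases "a = b")
      case True
      have "c *s x + v = shift a z + (c *s x + y)" by (simp add: zy)
      moreover have "c *s x + y \<in> gen_eigenspace a"
        using True b zy by (intro vec.subspace_add vec.subspace_scale subspace_gen_eigenspace) auto
      ultimately show ?thesis using zy by blast
    next
      case False
      then obtain z' where z': "z' \<in> gen_eigenspace b" "shift a z' = x" using shift_solve[OF b] by blast
      have "c *s x + v = shift a (c *s z' + z) + y" by (simp add: zy z' shift_simps)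
      moreover have "c *s z' + z \<in> ?S"
        using zy z' by (intro vec.span_add vec.span_scale) (auto intro: vec.span_base)
      ultimately show ?thesis using zy by blast
    qed
  qed
  then obtain z y where zy: "z \<in> ?S" "y \<in> gen_eigenspace a" "shift a w = shift a z + y" by blast
  then have "shift a (w - z) = y" by (simp add: shift_simps)
  then have "w - z \<in> gen_eigenspace a" using zy(2) by (auto intro: gen_eigenspace_shiftD)
  then have "(w - z) + z \<in> ?S" by (intro vec.span_add zy(1)) (auto intro: vec.span_base)
  then show ?thesis by simp
qed

section \<open>Polynomials in the operator and the primary decomposition\<close>

definition poly_op :: "complex poly \<Rightarrow> complex^'n \<Rightarrow> complex^'n" where
  "poly_op p v = fold_coeffs (\<lambda>c w. c *s v + A w) p 0"

lemma poly_op_0 [simp]: "poly_op 0 v = 0"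
  by (simp add: poly_op_def)

lemma poly_op_pCons [simp]: "poly_op (pCons c p) v = c *s v + A (poly_op p v)"
  by (cases "p = 0 \<and> c = 0") (auto simp: poly_op_def vec.linear_0[OF linear])

lemma poly_op_add: "poly_op (p + q) v = poly_op p v + poly_op q v"
  by (induction p q rule: poly_induct2)
     (simp_all add: vec.linear_add[OF linear] vector_sadd_rdistrib add_ac)

lemma poly_op_smult: "poly_op (smult c p) v = c *s poly_op p v"
  by (induction p)
     (simp_all add: vec.linear_scale[OF linear] vector_add_ldistrib vector_smult_assoc)

lemma poly_op_sum: "poly_op (\<Sum>i\<in>S. f i) v = (\<Sum>i\<in>S. poly_op (f i) v)"
  by (induction S rule: infinite_finite_induct) (simp_all add: poly_op_add)

lemma poly_op_linear_factor: "poly_op ([:- a, 1:] * q) v = shift a (poly_op q v)"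
proof -
  have "[:- a, 1:] * q = pCons 0 q + smult (- a) q" by simp
  then show ?thesis by (simp only: poly_op_add poly_op_smult poly_op_pCons) (simp add: shift_def)
qed

lemma poly_op_monom: "poly_op (monom c i) v = c *s (A ^^ i) v"
  by (induction i) (simp_all add: monom_Suc monom_0 vec.linear_0[OF linear] vec.linear_scale[OF linear])

text \<open>A complex polynomial splits, and \<open>span_shiftD\<close> strips off one linear factor
  at a time.\<close>

lemma poly_op_span:
  assumes "p \<noteq> 0" "poly_op p v \<in> vec.span (\<Union>(range gen_eigenspace))"
  shows "v \<in> vec.span (\<Union>(range gen_eigenspace))"
  using assms
proof (induction "degree p" arbitrary: p rule: less_induct)
  case less
  show ?case
  proof (cases "degree p = 0")
    case True
    then obtain c where c: "p = [:c:]" by (metis degree_eq_zeroE)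
    then have "(1 / c) *s poly_op p v \<in> vec.span (\<Union>(range gen_eigenspace))"
      using less.prems by (intro vec.span_scale)
    then show ?thesis using c less.prems(1) by (simp add: vec.linear_0[OF linear] vector_smult_assoc)
  next
    case False
    then obtain a where "poly p a = 0"
      using fundamental_theorem_of_algebra[of p] by (auto simp: constant_degree)
    then obtain q where q: "p = [:- a, 1:] * q" by (auto simp: poly_eq_0_iff_dvd elim: dvdE)
    then have "q \<noteq> 0" using less.prems(1) by auto
    moreover have "degree q < degree p" unfolding q using \<open>q \<noteq> 0\<close> by (subst degree_mult_eq) auto
    ultimately show ?thesis
      using less.hyps[of q] less.prems(2) span_shiftD unfolding q poly_op_linear_factor by blast
  qed
qed

lemma exists_annihilating_poly: "\<exists>p. p \<noteq> 0 \<and> poly_op p v = 0"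
proof -
  let ?f = "\<lambda>i. (A ^^ i) v" and ?I = "{..CARD('n)}"
  show ?thesis
  proof (cases "inj_on ?f ?I")
    case True
    then have card: "card (?f ` ?I) = Suc (CARD('n))" by (simp add: card_image)
    have "vec.dependent (?f ` ?I)"
      using vec.independent_card_le_dim[OF subset_UNIV, of "?f ` ?I"] card by (auto simp: vec_dim_card simp del: vec.dim_UNIV)
    then obtain u where u: "\<exists>w\<in>?f ` ?I. u w \<noteq> 0" "(\<Sum>w\<in>?f ` ?I. u w *s w) = 0"
      using vec.dependent_finite[of "?f ` ?I"] by blast
    define p where "p = (\<Sum>i\<in>?I. monom (u (?f i)) i)"
    have "poly_op p v = (\<Sum>i\<in>?I. u (?f i) *s ?f i)"
      by (simp add: p_def poly_op_sum poly_op_monom)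
    also have "\<dots> = 0" using u(2) by (simp add: sum.reindex[OF True])
    finally have p: "poly_op p v = 0" .
    obtain k where k: "k \<in> ?I" "u (?f k) \<noteq> 0" using u(1) by auto
    have "coeff p k = (\<Sum>i\<in>?I. if k = i then u (?f i) else 0)"
      unfolding p_def coeff_sum by (rule sum.cong) auto
    also have "\<dots> = u (?f k)" using k(1) by (simp only: sum.delta' finite_atMost if_True)
    finally have "p \<noteq> 0" using k(2) by auto
    with p show ?thesis by blast
  next
    case False
    \<comment> \<open>Coinciding iterates collapse in the image set, so its linear dependence would
      not be informative; the difference of two monomials annihilates \<open>v\<close>
      instead.\<close>
    then obtain i j where ij: "i \<noteq> j" "?f i = ?f j" by (auto simp: inj_on_def)
    have "poly_op (monom 1 i + monom (-1) j) v = 0"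
      by (simp only: poly_op_add poly_op_monom ij(2)) simp
    moreover have "coeff (monom 1 i + monom (-1 :: complex) j) i \<noteq> 0" using ij by simp
    then have "monom 1 i + monom (-1 :: complex) j \<noteq> 0" by (metis coeff_0)
    ultimately show ?thesis by blast
  qed
qed

lemma span_gen_eigenspaces: "vec.span (\<Union>(range gen_eigenspace)) = UNIV"
proof -
  have "v \<in> vec.span (\<Union>(range gen_eigenspace))" for v
  proof -
    obtain p where "p \<noteq> 0" "poly_op p v = 0" using exists_annihilating_poly by blast
    then show ?thesis using poly_op_span vec.span_zero by metis
  qed
  then show ?thesis by blast
qed

section \<open>Triangularizing bases of generalized eigenvectors\<close>

inductive adapted :: "(complex^'n) list \<Rightarrow> bool" where
  Nil: "adapted []"
| Cons: "adapted bs \<Longrightarrow> b \<in> gen_eigenspace a \<Longrightarrow> shift a b \<in> vec.span (set bs) \<Longrightarrow>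
    b \<notin> vec.span (set bs) \<Longrightarrow> adapted (b # bs)"

text \<open>The order of the list, which makes the operator triangular, is given up in favour of
  \<open>vec.span (set bs - {b})\<close>; this still determines the diagonal entries, hence the
  trace.\<close>

lemma adapted_properties:
  assumes "adapted bs"
  shows "vec.independent (set bs) \<and> distinct bs \<and>
    (\<forall>b\<in>set bs. \<exists>a. b \<in> gen_eigenspace a \<and> shift a b \<in> vec.span (set bs - {b}))"
  using assms
proof (induction rule: adapted.induct)
  case Nil
  then show ?case by (simp add: vec.independent_empty)
next
  case (Cons bs b a)
  have b: "b \<notin> set bs" using Cons.hyps(4) vec.span_base by blast
  have "\<exists>a'. c \<in> gen_eigenspace a' \<and> shift a' c \<in> vec.span (set (b # bs) - {c})" if c: "c \<in> set (b # bs)" for c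
  proof (cases "c = b")
    case True
    then have "set (b # bs) - {c} = set bs" using b by auto
    then show ?thesis using True Cons.hyps by auto
  next
    case False
    then obtain a' where "c \<in> gen_eigenspace a'" "shift a' c \<in> vec.span (set bs - {c})"
      using c Cons.IH by auto
    moreover have "vec.span (set bs - {c}) \<subseteq> vec.span (set (b # bs) - {c})"
      by (rule vec.span_mono) auto
    ultimately show ?thesis by blast
  qed
  moreover have "vec.independent (set (b # bs))"
    using vec.independent_insertI[OF Cons.hyps(4)] Cons.IH by simp
  ultimately show ?case
    using Cons.IH b by auto
qed

text \<open>A longest adapted list spans. Otherwise some generalized eigenvector lies outside the
  span; among its images under powers of \<open>shift a\<close>, the one just before the first to
  fall inside could be prepended.\<close>

lemma adapted_basis:
  obtains B where "finite B" "vec.independent B" "vec.span B = UNIV"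
    "\<And>b. b \<in> B \<Longrightarrow> \<exists>a. b \<in> gen_eigenspace a \<and> shift a b \<in> vec.span (B - {b})"
proof -
  have bound: "\<forall>bs. adapted bs \<longrightarrow> length bs < Suc (CARD('n))"
  proof (intro allI impI)
    fix bs assume "adapted bs"
    then have "vec.independent (set bs)" "distinct bs" using adapted_properties by auto
    then show "length bs < Suc (CARD('n))"
      using vec.independent_card_le_dim[OF subset_UNIV, of "set bs"]
      by (simp add: vec_dim_card distinct_card less_Suc_eq_le del: vec.dim_UNIV)
  qed
  obtain bs where bs: "adapted bs" "\<And>bs'. adapted bs' \<Longrightarrow> length bs' \<le> length bs"
    using ex_has_greatest_nat[OF adapted.Nil bound] by blast
  have "\<Union>(range gen_eigenspace) \<subseteq> vec.span (set bs)"
  proof (rule ccontr)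
    assume "\<not> ?thesis"
    then obtain v a where v: "v \<in> gen_eigenspace a" "v \<notin> vec.span (set bs)" by auto
    define m where "m = (LEAST m. (shift a ^^ m) v \<in> vec.span (set bs))"
    obtain k where "(shift a ^^ k) v = 0" using v(1) by (auto simp: gen_eigenspace_def)
    then have m: "(shift a ^^ m) v \<in> vec.span (set bs)"
      unfolding m_def by (metis (mono_tags, lifting) LeastI vec.span_zero)
    obtain j where j: "m = Suc j" using m v(2) by (cases m) auto
    have "(shift a ^^ j) v \<notin> vec.span (set bs)"
      using not_less_Least[of j "\<lambda>m. (shift a ^^ m) v \<in> vec.span (set bs)"] j m_def by simp
    then have "adapted ((shift a ^^ j) v # bs)"
      using m by (intro adapted.Cons[OF bs(1) shift_funpow_gen_eigenspace[OF v(1)]]) (simp_all add: j)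
    then show False using bs(2) by fastforce
  qed
  then have "vec.span (\<Union>(range gen_eigenspace)) \<subseteq> vec.span (set bs)"
    by (rule vec.span_minimal) (rule vec.subspace_span)
  then have "vec.span (set bs) = UNIV" unfolding span_gen_eigenspaces by blast
  with adapted_properties[OF bs(1)] show thesis by (intro that[of "set bs"]) auto
qed

end

lemma op_trace_basis:
  assumes "finite B" "vec.independent B" "vec.span B = UNIV" "clinear f"
  shows "op_trace f = (\<Sum>b\<in>B. vec.representation B (f b) b)"
proof -
  have e: "(\<Sum>b\<in>B. vec.representation B v b *s b) = v" for v
    using assms by (intro vec.sum_representation_eq) auto
  have "op_trace f = (\<Sum>i\<in>UNIV. f (\<Sum>b\<in>B. vec.representation B (axis i 1) b *s b) $ i)"
    by (simp add: op_trace_def e)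
  also have "\<dots> = (\<Sum>i\<in>UNIV. \<Sum>b\<in>B. vec.representation B (axis i 1) b * f b $ i)"
    by (simp only: vec.linear_sum[OF assms(4)] vec.linear_scale[OF assms(4)] sum_component vector_smult_component)
  also have "\<dots> = (\<Sum>b\<in>B. \<Sum>i\<in>UNIV. f b $ i * vec.representation B (axis i 1) b)"
    by (subst sum.swap) (simp add: mult.commute)
  also have "\<dots> = (\<Sum>b\<in>B. vec.representation B (\<Sum>i\<in>UNIV. f b $ i *s axis i 1) b)"
    using assms(2,3) by (simp add: vec.representation_sum vec.representation_scale)
  finally show ?thesis by (simp add: basis_expansion)
qed

context complex_operator
begin

text \<open>\<open>D\<close> is the complex conjugate of the semisimple part of \<open>A\<close>; its trace against \<open>A\<close> is the sum of
  the \<open>\<bar>a\<bar>\<^sup>2\<close> over the eigenvalues \<open>a\<close> with multiplicity.\<close>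

lemma conjugate_operator:
  obtains D where "clinear D" "\<And>a u. u \<in> gen_eigenspace a \<Longrightarrow> D u = cnj a *s u"
    "op_trace (\<lambda>z. A (D z)) = 0 \<Longrightarrow> gen_eigenspace 0 = UNIV"
proof -
  obtain B where B: "finite B" "vec.independent B" "vec.span B = UNIV"
    and ex: "\<And>b. b \<in> B \<Longrightarrow> \<exists>a. b \<in> gen_eigenspace a \<and> shift a b \<in> vec.span (B - {b})"
    using adapted_basis by blast
  obtain \<alpha> where \<alpha>: "\<And>b. b \<in> B \<Longrightarrow> b \<in> gen_eigenspace (\<alpha> b)"
    "\<And>b. b \<in> B \<Longrightarrow> shift (\<alpha> b) b \<in> vec.span (B - {b})"
    using ex by metis
  obtain D where D: "clinear D" "\<And>b. b \<in> B \<Longrightarrow> D b = cnj (\<alpha> b) *s b"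
    using vec.linear_independent_extend[OF B(2), of "\<lambda>b. cnj (\<alpha> b) *s b"] by blast
  \<comment> \<open>\<open>D\<close> is prescribed on \<open>B\<close> only. To see that it scales
    all of \<open>gen_eigenspace a\<close>, \<open>u\<close> is expanded in \<open>B\<close> and
    grouped by eigenvalue; independence leaves only the group of \<open>a\<close>.\<close>
  have eig: "D u = cnj a *s u" if u: "u \<in> gen_eigenspace a" for a u
  proof -
    let ?r = "vec.representation B u"
    define U where "U c = (\<Sum>b\<in>{b\<in>B. \<alpha> b = c}. ?r b *s b)" for c
    define F where "F = insert a (\<alpha> ` B)"
    have F: "finite F" "\<alpha> ` B \<subseteq> F" "a \<in> F" using B by (auto simp: F_def)
    have e: "(\<Sum>b\<in>B. ?r b *s b) = u"
      using B by (intro vec.sum_representation_eq) auto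
    have sumU: "(\<Sum>c\<in>F. U c) = u"
      using sum.group[OF B(1) F(1,2), of "\<lambda>b. ?r b *s b"] by (simp add: U_def e)
    have "U c - (if c = a then u else 0) = 0" if "c \<in> F" for c
    proof (rule gen_eigenspaces_independent[OF F(1) _ _ that])
      show "U c - (if c = a then u else 0) \<in> gen_eigenspace c" for c
        unfolding U_def using u vec.subspace_0[OF subspace_gen_eigenspace]
        by (intro vec.subspace_diff vec.subspace_sum vec.subspace_scale subspace_gen_eigenspace)
           (auto intro: \<alpha>(1))
      show "(\<Sum>c\<in>F. U c - (if c = a then u else 0)) = 0"
        using F by (simp add: sum_subtractf sumU)
    qed
    then have U: "U c = (if c = a then u else 0)" if "c \<in> F" for c using that by simp
    have "D u = (\<Sum>b\<in>B. cnj (\<alpha> b) *s (?r b *s b))"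
      by (subst (1) e[symmetric])
         (simp add: vec.linear_sum[OF D(1)] vec.linear_scale[OF D(1)] D(2) vector_smult_assoc mult.commute)
    also have "\<dots> = (\<Sum>c\<in>F. \<Sum>b\<in>{b\<in>B. \<alpha> b = c}. cnj (\<alpha> b) *s (?r b *s b))"
      by (rule sum.group[OF B(1) F(1,2), symmetric])
    also have "\<dots> = (\<Sum>c\<in>F. cnj c *s U c)"
      unfolding U_def vec.scale_sum_right by (intro sum.cong refl) auto
    also have "\<dots> = (\<Sum>c\<in>F. if c = a then cnj a *s u else 0)"
      by (intro sum.cong refl) (auto simp: U)
    finally show ?thesis using F by simp
  qed
  have "gen_eigenspace 0 = UNIV" if tr: "op_trace (\<lambda>z. A (D z)) = 0"
  proof -
    have AD: "clinear (\<lambda>z. A (D z))"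
      by (rule clinearI) (simp_all add: vec.linear_add[OF linear] vec.linear_add[OF D(1)]
          vec.linear_scale[OF linear] vec.linear_scale[OF D(1)])
    \<comment> \<open>\<open>shift (\<alpha> b) b\<close> has no component along \<open>b\<close>,
      so the diagonal entry is the product of the two eigenvalues.\<close>
    have "vec.representation B (A (D b)) b = of_real ((cmod (\<alpha> b))\<^sup>2)" if b: "b \<in> B" for b
    proof -
      have ind: "vec.independent (B - {b})" by (rule vec.independent_mono[OF B(2)]) auto
      have "vec.representation B (shift (\<alpha> b) b) = vec.representation (B - {b}) (shift (\<alpha> b) b)"
        by (rule vec.representation_extend[OF B(2) \<alpha>(2)[OF b]]) auto
      then have low: "vec.representation B (shift (\<alpha> b) b) b = 0"
        using vec.representation_ne_zero[of "B - {b}" _ b] by auto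
      have "A (D b) = cnj (\<alpha> b) *s (\<alpha> b *s b + shift (\<alpha> b) b)"
        by (simp add: D(2)[OF b] vec.linear_scale[OF linear] shift_def)
      then have "vec.representation B (A (D b)) b = cnj (\<alpha> b) * \<alpha> b"
        using B b by (simp add: vec.representation_scale vec.representation_add low vec.representation_basis)
      then show ?thesis by (simp only: complex_norm_square mult.commute)
    qed
    then have "of_real (\<Sum>b\<in>B. (cmod (\<alpha> b))\<^sup>2) = op_trace (\<lambda>z. A (D z))"
      by (simp add: op_trace_basis[OF B AD])
    then have "(\<Sum>b\<in>B. (cmod (\<alpha> b))\<^sup>2) = 0" using tr by (simp only: of_real_eq_0_iff)
    then have "\<alpha> b = 0" if "b \<in> B" for b
      using that B(1) by (subst (asm) sum_nonneg_eq_0_iff) auto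
    then have "B \<subseteq> gen_eigenspace 0" using \<alpha>(1) by force
    then have "vec.span B \<subseteq> gen_eigenspace 0" by (rule vec.span_minimal) (rule subspace_gen_eigenspace)
    then show ?thesis using B by blast
  qed
  with D(1) eig show thesis by (rule that)
qed

end

section \<open>Cartan's criterion and Engel's theorem\<close>

context lie_algebra
begin

lemma complex_operator_ad: "complex_operator (\<mu> x)"
  by (rule complex_operator.intro) (rule linear_right)

definition ad_nilpotent :: "complex^'n \<Rightarrow> bool" where
  "ad_nilpotent x \<longleftrightarrow> (\<forall>v. \<exists>m. (\<mu> x ^^ m) v = 0)"

text \<open>\<open>shift (a + b)\<close> obeys a Leibniz rule with \<open>shift a\<close> and
  \<open>shift b\<close> on the factors, so each application lowers one of the two nilpotency
  exponents; induction on their sum stands in for a binomial formula.\<close>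

lemma bracket_gen_eigenspaces:
  assumes "u \<in> complex_operator.gen_eigenspace (\<mu> x) a" "w \<in> complex_operator.gen_eigenspace (\<mu> x) b"
  shows "\<mu> u w \<in> complex_operator.gen_eigenspace (\<mu> x) (a + b)"
proof -
  interpret complex_operator "\<mu> x" by (rule complex_operator_ad)
  have step: "shift (a + b) (\<mu> u w) = \<mu> (shift a u) w + \<mu> u (shift b w)" for u w
    by (simp add: shift_def leibniz[of x u w] diff_left diff_right scale_left scale_right
        vector_sadd_rdistrib algebra_simps)
  have "(shift a ^^ i) u = 0 \<Longrightarrow> (shift b ^^ j) w = 0 \<Longrightarrow> \<mu> u w \<in> gen_eigenspace (a + b)" for i j u w
  proof (induction "i + j" arbitrary: i j u w)
    case 0
    then show ?case using vec.subspace_0[OF subspace_gen_eigenspace] by simp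
  next
    case (Suc k)
    show ?case
    proof (cases "i = 0 \<or> j = 0")
      case True
      then show ?thesis using Suc.prems vec.subspace_0[OF subspace_gen_eigenspace] by auto
    next
      case False
      then obtain i' j' where ij: "i = Suc i'" "j = Suc j'" by (metis not0_implies_Suc)
      have s: "(shift a ^^ i') (shift a u) = 0" "(shift b ^^ j') (shift b w) = 0"
        using Suc.prems unfolding ij funpow_Suc_right o_def by auto
      have k: "k = i' + j" "k = i + j'" using Suc.hyps(2) ij by auto
      have "\<mu> (shift a u) w \<in> gen_eigenspace (a + b)"
        by (rule Suc.hyps(1)[OF k(1) s(1) Suc.prems(2)])
      moreover have "\<mu> u (shift b w) \<in> gen_eigenspace (a + b)"
        by (rule Suc.hyps(1)[OF k(2) Suc.prems(1) s(2)])
      ultimately have "shift (a + b) (\<mu> u w) \<in> gen_eigenspace (a + b)"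
        unfolding step by (rule vec.subspace_add[OF subspace_gen_eigenspace])
      then show ?thesis by (rule gen_eigenspace_shiftD)
    qed
  qed
  with assms show ?thesis unfolding gen_eigenspace_def by blast
qed

text \<open>The conjugate \<open>D\<close> of \<open>\<mu> x\<close> is a derivation, because conjugation is additive on eigenvalues. Hence
  \<open>tr (ad [p, q] D) = - \<kappa>(p, D q)\<close>, which vanishes for \<open>p\<close> in the radical of \<open>\<kappa>\<close>.\<close>

lemma ad_nilpotent_of_trace:
  assumes x: "x \<in> vec.span {\<mu> p q | p q. \<forall>y. killing \<mu> p y = 0}"
  shows "ad_nilpotent x"
proof -
  interpret complex_operator "\<mu> x" by (rule complex_operator_ad)
  obtain D where D: "clinear D" "\<And>a u. u \<in> gen_eigenspace a \<Longrightarrow> D u = cnj a *s u"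
    and trace: "op_trace (\<lambda>z. \<mu> x (D z)) = 0 \<Longrightarrow> gen_eigenspace 0 = UNIV"
    using conjugate_operator by blast
  note D_simps = vec.linear_add[OF D(1)] vec.linear_scale[OF D(1)] vec.linear_0[OF D(1)]
  have "D (\<mu> u w) = \<mu> (D u) w + \<mu> u (D w)" for u w
  proof -
    have 1: "D (\<mu> u w) = \<mu> (D u) w + \<mu> u (D w)" if "u \<in> gen_eigenspace a" "w \<in> gen_eigenspace b" for u w a b
      using that bracket_gen_eigenspaces[OF that]
      by (simp add: D(2) scale_left scale_right vector_sadd_rdistrib)
    have 2: "D (\<mu> u w) = \<mu> (D u) w + \<mu> u (D w)" if u: "u \<in> gen_eigenspace a" for u w a
    proof -
      have "w \<in> vec.span (\<Union>(range gen_eigenspace))" by (simp add: span_gen_eigenspaces)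
      then show ?thesis
      proof (induction rule: vec.span_induct_alt)
        case (step c v w)
        then obtain b where "v \<in> gen_eigenspace b" by auto
        then show ?case using 1[OF u, of v b] step
          by (simp add: D_simps add_right scale_right vector_add_ldistrib algebra_simps)
      qed (simp add: D_simps)
    qed
    have "u \<in> vec.span (\<Union>(range gen_eigenspace))" by (simp add: span_gen_eigenspaces)
    then show ?thesis
    proof (induction rule: vec.span_induct_alt)
      case (step c v u)
      then obtain b where "v \<in> gen_eigenspace b" by auto
      then show ?case using 2[of v b w] step
        by (simp add: D_simps add_left scale_left vector_add_ldistrib algebra_simps)
    qed (simp add: D_simps)
  qed
  note derivation = this
  have "op_trace (\<lambda>z. \<mu> x (D z)) = 0"
    using x
  proof (induction rule: vec.span_induct_alt)
    case base
    then show ?case by (simp add: op_trace_def)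
  next
    case (step c v w)
    then obtain p q where v: "v = \<mu> p q" and p: "\<And>y. killing \<mu> p y = 0" by auto
    have lin: "clinear (\<lambda>z. \<mu> p (D z))"
      by (rule clinearI) (simp_all add: D_simps add_right scale_right)
    have "op_trace (\<lambda>z. \<mu> v (D z)) = op_trace (\<lambda>z. \<mu> p (\<mu> q (D z))) - op_trace (\<lambda>z. \<mu> q (\<mu> p (D z)))"
      unfolding v by (simp add: leibniz[of p q] flip: op_trace_diff)
    also have "op_trace (\<lambda>z. \<mu> q (\<mu> p (D z))) = op_trace (\<lambda>z. \<mu> p (D (\<mu> q z)))"
      by (rule op_trace_commute[OF linear_right lin])
    also have "op_trace (\<lambda>z. \<mu> p (\<mu> q (D z))) - \<dots> = - killing \<mu> p (D q)"
    proof -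
      have "op_trace (\<lambda>z. \<mu> p (D (\<mu> q z))) = killing \<mu> p (D q) + op_trace (\<lambda>z. \<mu> p (\<mu> q (D z)))"
        unfolding killing_def by (simp add: derivation add_right flip: op_trace_add)
      then show ?thesis by simp
    qed
    finally have "op_trace (\<lambda>z. \<mu> v (D z)) = 0" using p by simp
    then show ?case
      using step by (simp add: add_left scale_left op_trace_add op_trace_scale)
  qed
  then have "gen_eigenspace 0 = UNIV" by (rule trace)
  then have "\<exists>m. (shift 0 ^^ m) v = 0" for v unfolding gen_eigenspace_def by blast
  moreover have "shift 0 = \<mu> x" by (simp add: shift_def fun_eq_iff)
  ultimately show ?thesis unfolding ad_nilpotent_def by simp
qed

section \<open>Nilpotent families of adjoint operators and Engel's theorem\<close>

lemma ad_nilpotent_uniform: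
  assumes "ad_nilpotent x"
  obtains k where "\<And>v. (\<mu> x ^^ k) v = 0"
proof -
  interpret complex_operator "\<mu> x" by (rule complex_operator_ad)
  have s: "shift 0 = \<mu> x" by (simp add: shift_def fun_eq_iff)
  have "\<forall>i. \<exists>m. (\<mu> x ^^ m) (axis i 1) = 0"
    using assms unfolding ad_nilpotent_def by blast
  then obtain m where m: "\<And>i. (\<mu> x ^^ m i) (axis i 1) = 0"
    by (auto dest!: choice)
  have "(\<mu> x ^^ Max (range m)) v = 0" for v
  proof -
    have "m i \<le> Max (range m)" for i by simp
    then have "(\<mu> x ^^ Max (range m)) (axis i 1) = 0" for i
      using shift_funpow_zero_mono[of "m i" 0 "axis i 1" "Max (range m)"] m unfolding s by blast
    then show ?thesis
      using clinear_basis[OF linear_shift_funpow[of "Max (range m)" 0], of v] unfolding s by (simp only:) simp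
  qed
  then show thesis by (rule that)
qed

text \<open>The span of words in \<open>ad W\<close> of length \<open>k\<close> applied to
  \<open>S\<close>. Vanishing for \<open>S = UNIV\<close> says that the associative algebra
  generated by \<open>ad W\<close> is nilpotent. A variable \<open>S\<close> lets the series restart
  from an intermediate stage or run inside an ideal.\<close>

primrec act_series :: "(complex^'n) set \<Rightarrow> (complex^'n) set \<Rightarrow> nat \<Rightarrow> (complex^'n) set" where
  "act_series W S 0 = S"
| "act_series W S (Suc k) = vec.span {\<mu> w v | w v. w \<in> W \<and> v \<in> act_series W S k}"

lemma act_series_add: "act_series W S (i + j) = act_series W (act_series W S i) j"
  by (induction j) simp_all

lemma act_series_mono:
  assumes "W \<subseteq> W'" "S \<subseteq> S'"
  shows "act_series W S k \<subseteq> act_series W' S' k"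
proof (induction k)
  case (Suc k)
  then show ?case using assms(1) by (auto intro!: vec.span_mono)
qed (simp add: assms)

lemma subspace_act_series:
  assumes "vec.subspace S"
  shows "vec.subspace (act_series W S k)"
  using assms by (cases k) simp_all

lemma act_series_Suc: "w \<in> W \<Longrightarrow> v \<in> act_series W S k \<Longrightarrow> \<mu> w v \<in> act_series W S (Suc k)"
  by (auto intro!: vec.span_base)

lemma act_series_decreasing: "act_series W UNIV (Suc k) \<subseteq> act_series W UNIV k"
proof (induction k)
  case (Suc k)
  have "act_series W UNIV (Suc (Suc k)) = vec.span {\<mu> w v | w v. w \<in> W \<and> v \<in> act_series W UNIV (Suc k)}"
    by (rule act_series.simps(2))
  also have "\<dots> \<subseteq> vec.span {\<mu> w v | w v. w \<in> W \<and> v \<in> act_series W UNIV k}"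
    using Suc by (intro vec.span_mono) blast
  finally show ?case by simp
qed simp

lemma act_series_normalizer:
  assumes "\<And>w. w \<in> W \<Longrightarrow> \<mu> x w \<in> W" "v \<in> act_series W UNIV k"
  shows "\<mu> x v \<in> act_series W UNIV k"
  using assms(2)
proof (induction k arbitrary: v)
  case (Suc k)
  from Suc.prems have "v \<in> vec.span {\<mu> w v | w v. w \<in> W \<and> v \<in> act_series W UNIV k}" by simp
  then show ?case
  proof (induction rule: vec.span_induct_alt)
    case base
    then show ?case by (simp add: vec.span_zero)
  next
    case (step c y z)
    then obtain w v where y: "y = \<mu> w v" "w \<in> W" "v \<in> act_series W UNIV k"
      using step.hyps(1) by blast
    have "\<mu> x y = \<mu> (\<mu> x w) v + \<mu> w (\<mu> x v)" unfolding y by (rule leibniz)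
    also have "\<dots> \<in> act_series W UNIV (Suc k)"
      by (intro vec.subspace_add subspace_act_series vec.subspace_UNIV act_series_Suc assms(1) y Suc.IH)
    finally show ?case
      using step.IH unfolding add_right scale_right
      by (intro vec.subspace_add vec.subspace_scale subspace_act_series vec.subspace_UNIV)
  qed
qed simp

definition nil_subalgebra :: "(complex^'n) set \<Rightarrow> bool" where
  "nil_subalgebra W \<longleftrightarrow> vec.subspace W \<and> (\<forall>w\<in>W. \<forall>w'\<in>W. \<mu> w w' \<in> W) \<and> (\<exists>N. act_series W UNIV N \<subseteq> {0})"

text \<open>Let \<open>V j\<close> be the series of \<open>W\<close>. In a letter
  \<open>c *s x + w\<close>, the part \<open>w\<close> maps \<open>V j\<close> into
  \<open>V (Suc j)\<close>, and \<open>x\<close> preserves both because it normalizes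
  \<open>W\<close>. Modulo \<open>V (Suc j)\<close>, a word of length \<open>k\<close> on
  \<open>V j\<close> thus reduces to the \<open>k\<close>-th power of \<open>ad x\<close>, which is
  0; hence \<open>N * k\<close> letters annihilate everything.\<close>

lemma nil_subalgebra_extend:
  assumes W: "nil_subalgebra W" and x: "\<And>w. w \<in> W \<Longrightarrow> \<mu> x w \<in> W" "ad_nilpotent x"
  shows "nil_subalgebra (vec.span (insert x W))"
proof -
  define W' where "W' = vec.span (insert x W)"
  define V where "V j = act_series W UNIV j" for j
  have sub: "vec.subspace W" and alg: "\<And>w w'. w \<in> W \<Longrightarrow> w' \<in> W \<Longrightarrow> \<mu> w w' \<in> W"
    using W by (auto simp: nil_subalgebra_def)
  obtain N where N: "V N \<subseteq> {0}" using W by (auto simp: nil_subalgebra_def V_def)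
  obtain k where k: "\<And>v. (\<mu> x ^^ k) v = 0" using ad_nilpotent_uniform[OF x(2)] by blast
  have V_sub: "vec.subspace (V j)" for j
    unfolding V_def by (intro subspace_act_series vec.subspace_UNIV)
  have V_x: "\<mu> x v \<in> V j" if "v \<in> V j" for v j
    using act_series_normalizer[OF x(1)] that unfolding V_def by blast
  have V_xl: "(\<mu> x ^^ l) v \<in> V j" if "v \<in> V j" for v j l
    by (induction l) (simp_all add: that V_x)
  have V_w: "\<mu> w v \<in> V (Suc j)" if "w \<in> W" "v \<in> V j" for w v j
    using act_series_Suc that unfolding V_def by blast
  have V_dec: "V (Suc j) \<subseteq> V j" for j
    unfolding V_def by (rule act_series_decreasing)
  have W': "\<exists>c w. w \<in> W \<and> u = c *s x + w" if u: "u \<in> W'" for u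
  proof -
    obtain c where "u - c *s x \<in> vec.span W" using u unfolding W'_def vec.span_insert by blast
    moreover have "vec.span W = W" using sub by (simp add: vec.span_eq_iff)
    ultimately show ?thesis by (intro exI[of _ c] exI[of _ "u - c *s x"]) simp
  qed
  have words: "act_series W' (V j) l \<subseteq> vec.span ((\<mu> x ^^ l) ` V j \<union> V (Suc j))" for j l
  proof (induction l)
    case 0
    then show ?case by (auto intro: vec.span_base)
  next
    case (Suc l)
    let ?T = "vec.span ((\<mu> x ^^ Suc l) ` V j \<union> V (Suc j))"
    have "\<mu> u r \<in> ?T" if u: "u \<in> W'" and "r \<in> vec.span ((\<mu> x ^^ l) ` V j \<union> V (Suc j))" for u r
      using that(2)
    proof (induction rule: vec.span_induct_alt)
      case base
      then show ?case by (simp add: vec.span_zero)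
    next
      case (step c y z)
      obtain d w where w: "w \<in> W" "u = d *s x + w" using W'[OF u] by blast
      have "\<mu> x y \<in> ?T \<and> \<mu> w y \<in> V (Suc j)"
      proof (cases "y \<in> V (Suc j)")
        case True
        then show ?thesis using V_x V_w[OF w(1) True] V_dec by (blast intro: vec.span_base)
      next
        case False
        then obtain v where v: "v \<in> V j" "y = (\<mu> x ^^ l) v" using step.hyps(1) by blast
        have "\<mu> x y = (\<mu> x ^^ Suc l) v" by (simp add: v)
        then have "\<mu> x y \<in> (\<mu> x ^^ Suc l) ` V j" using v(1) by blast
        then show ?thesis using V_w[OF w(1) V_xl[OF v(1)]] unfolding v(2) by (blast intro: vec.span_base)
      qed
      then have "c *s (d *s \<mu> x y + \<mu> w y) + \<mu> u z \<in> ?T"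
        using step.IH by (intro vec.span_add vec.span_scale) (auto intro: vec.span_base)
      then show ?case by (simp only: w(2) add_left add_right scale_left scale_right)
    qed
    then have "{\<mu> u r | u r. u \<in> W' \<and> r \<in> act_series W' (V j) l} \<subseteq> ?T"
      using Suc by blast
    then have "vec.span {\<mu> u r | u r. u \<in> W' \<and> r \<in> act_series W' (V j) l} \<subseteq> ?T"
      by (rule vec.span_minimal) (rule vec.subspace_span)
    then show ?case by simp
  qed
  have step: "act_series W' (V j) k \<subseteq> V (Suc j)" for j
  proof -
    have "(\<mu> x ^^ k) ` V j \<union> V (Suc j) \<subseteq> V (Suc j)"
      using vec.subspace_0[OF V_sub] by (auto simp: k)
    then have "vec.span ((\<mu> x ^^ k) ` V j \<union> V (Suc j)) \<subseteq> V (Suc j)"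
      by (rule vec.span_minimal) (rule V_sub)
    with words show ?thesis by blast
  qed
  have "act_series W' UNIV (j * k) \<subseteq> V j" for j
  proof (induction j)
    case 0
    then show ?case by (simp add: V_def)
  next
    case (Suc j)
    have "act_series W' UNIV (Suc j * k) = act_series W' (act_series W' UNIV (j * k)) k"
      by (simp add: act_series_add flip: add.commute[of "j * k"])
    also have "\<dots> \<subseteq> act_series W' (V j) k" by (rule act_series_mono[OF order_refl Suc])
    also have "\<dots> \<subseteq> V (Suc j)" by (rule step)
    finally show ?case .
  qed
  with N have "act_series W' UNIV (N * k) \<subseteq> {0}" by blast
  moreover have "\<mu> u u' \<in> W'" if uu: "u \<in> W'" "u' \<in> W'" for u u'
  proof -
    obtain c w d w' where w: "w \<in> W" "u = c *s x + w" "w' \<in> W" "u' = d *s x + w'"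
      using W'[OF uu(1)] W'[OF uu(2)] by blast
    have "\<mu> u u' = c *s \<mu> x w' - d *s \<mu> x w + \<mu> w w'"
      unfolding w by (simp add: add_left add_right scale_left scale_right skew[of w x])
    also have "\<dots> \<in> W"
      using w by (intro vec.subspace_add vec.subspace_diff vec.subspace_scale sub x alg)
    finally show ?thesis by (auto simp: W'_def intro: vec.span_base)
  qed
  ultimately show ?thesis
    unfolding nil_subalgebra_def W'_def[symmetric] by (auto simp: W'_def)
qed

text \<open>Take a nil subalgebra \<open>W\<close> of largest dimension inside \<open>I\<close>. If
  it is proper, words in \<open>W\<close> eventually carry \<open>I\<close> into \<open>W\<close>,
  so some \<open>x\<close> of \<open>I\<close> outside \<open>W\<close> is sent into
  \<open>W\<close> by all of \<open>W\<close>. This \<open>x\<close> normalizes \<open>W\<close> and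
  enlarges it, a contradiction.\<close>

lemma engel:
  assumes I: "lie_ideal \<mu> I" and nil: "\<And>x. x \<in> I \<Longrightarrow> ad_nilpotent x"
  shows "nil_subalgebra I"
proof -
  have sub: "vec.subspace I" and ideal: "\<And>x y. y \<in> I \<Longrightarrow> \<mu> x y \<in> I"
    using I by (auto simp: lie_ideal_def)
  have "act_series {0} UNIV (Suc 0) \<subseteq> {0}"
    unfolding act_series.simps by (rule vec.span_minimal) (auto simp: vec.subspace_single_0)
  then have "nil_subalgebra {0}"
    unfolding nil_subalgebra_def using vec.subspace_single_0 by (metis singletonD singletonI zero_left)
  then have zero: "nil_subalgebra {0} \<and> {0} \<subseteq> I"
    using vec.subspace_0[OF sub] by simp
  have bound: "\<forall>W. nil_subalgebra W \<and> W \<subseteq> I \<longrightarrow> vec.dim W < Suc (CARD('n))"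
    by (simp only: less_Suc_eq_le dim_subset_UNIV_cart_gen simp_thms)
  have "\<exists>W. (nil_subalgebra W \<and> W \<subseteq> I) \<and>
      (\<forall>W'. nil_subalgebra W' \<and> W' \<subseteq> I \<longrightarrow> vec.dim W' \<le> vec.dim W)"
    by (rule ex_has_greatest_nat[OF zero bound])
  then obtain W where W: "nil_subalgebra W" "W \<subseteq> I"
    and max: "\<And>W'. nil_subalgebra W' \<Longrightarrow> W' \<subseteq> I \<Longrightarrow> vec.dim W' \<le> vec.dim W"
    by blast
  have "I \<subseteq> W"
  proof (rule ccontr)
    assume "\<not> I \<subseteq> W"
    have Wsub: "vec.subspace W" using W by (simp add: nil_subalgebra_def)
    obtain N where "act_series W UNIV N \<subseteq> {0}" using W by (auto simp: nil_subalgebra_def)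
    then have N: "act_series W I N \<subseteq> W"
      using act_series_mono[OF order_refl subset_UNIV, of W I N] vec.subspace_0[OF Wsub] by blast
    \<comment> \<open>\<open>j\<close> is positive because \<open>I\<close> itself is not inside
      \<open>W\<close>; the stage just before it supplies \<open>x\<close>.\<close>
    define j where "j = (LEAST j. act_series W I j \<subseteq> W)"
    have j: "act_series W I j \<subseteq> W" unfolding j_def using N by (rule LeastI)
    then obtain i where i: "j = Suc i" using \<open>\<not> I \<subseteq> W\<close> by (cases j) auto
    have "\<not> act_series W I i \<subseteq> W"
      using not_less_Least[of i "\<lambda>j. act_series W I j \<subseteq> W"] i j_def by simp
    then obtain x where x: "x \<in> act_series W I i" "x \<notin> W" by blast
    have "act_series W I l \<subseteq> I" for l
    proof (induction l)
      case (Suc l)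
      have "vec.span {\<mu> w v | w v. w \<in> W \<and> v \<in> act_series W I l} \<subseteq> I"
        by (rule vec.span_minimal[OF _ sub]) (use Suc ideal in blast)
      then show ?case by simp
    qed simp
    then have xI: "x \<in> I" using x by blast
    have "\<mu> x w \<in> W" if "w \<in> W" for w
    proof -
      have "\<mu> w x \<in> W" using act_series_Suc[OF that x(1)] j i by blast
      then show ?thesis using vec.subspace_neg[OF Wsub] skew[of x w] by metis
    qed
    then have "nil_subalgebra (vec.span (insert x W))"
      using nil_subalgebra_extend[OF W(1)] nil[OF xI] by blast
    moreover have "vec.span (insert x W) \<subseteq> I"
      using xI W(2) by (intro vec.span_minimal sub) auto
    ultimately have "vec.dim (vec.span (insert x W)) \<le> vec.dim W" by (rule max)
    moreover have "x \<notin> vec.span W" using x(2) Wsub by (metis vec.span_eq_iff)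
    ultimately show False by (simp add: vec.dim_insert)
  qed
  then show ?thesis using W by auto
qed

text \<open>In each bracket of the derived series one factor is regarded merely as a letter from
  \<open>I\<close>, so the series stays inside \<open>act_series I UNIV\<close>.\<close>

lemma nil_subalgebra_solvable:
  assumes "nil_subalgebra I"
  shows "lie_solvable \<mu> I"
proof -
  have sub: "vec.subspace I" and alg: "\<And>w w'. w \<in> I \<Longrightarrow> w' \<in> I \<Longrightarrow> \<mu> w w' \<in> I"
    using assms by (auto simp: nil_subalgebra_def)
  obtain N where N: "act_series I UNIV N \<subseteq> {0}" using assms by (auto simp: nil_subalgebra_def)
  have "vec.subspace (derived_series \<mu> I k) \<and> derived_series \<mu> I k \<subseteq> I \<and> derived_series \<mu> I k \<subseteq> act_series I UNIV k" for k
  proof (induction k)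
    case (Suc k)
    let ?S = "{\<mu> X Y | X Y. X \<in> derived_series \<mu> I k \<and> Y \<in> derived_series \<mu> I k}"
    have "?S \<subseteq> I" using Suc alg by blast
    then have "vec.span ?S \<subseteq> I" by (rule vec.span_minimal) (rule sub)
    moreover have "vec.span ?S \<subseteq> vec.span {\<mu> w v | w v. w \<in> I \<and> v \<in> act_series I UNIV k}"
      by (rule vec.span_mono) (use Suc in blast)
    ultimately show ?case by simp
  qed (simp add: sub)
  then have "derived_series \<mu> I N = {0}"
    using N vec.subspace_0 by blast
  then show ?thesis unfolding lie_solvable_def by blast
qed

text \<open>With \<open>R\<close> the radical of the Killing form, the ideal \<open>I\<close>
  spanned by the brackets of \<open>R\<close> with the whole algebra consists of ad-nilpotent
  elements. Engel makes it solvable, and semisimplicity makes it zero. Then \<open>R\<close> is an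
  abelian ideal, hence zero as well.\<close>

theorem cartan_criterion:
  assumes "lie_semisimple \<mu>"
  shows "killing_nondegenerate \<mu>"
proof -
  define R where "R = {p. \<forall>y. killing \<mu> p y = 0}"
  define I where "I = vec.span {\<mu> p q | p q. p \<in> R}"
  have R_ideal: "\<mu> z p \<in> R" if "p \<in> R" for p z
  proof -
    have "killing \<mu> (\<mu> z p) y = 0" for y
    proof -
      have "killing \<mu> (\<mu> z p) y = - killing \<mu> (\<mu> p z) y" by (subst skew) (rule killing_neg)
      then show ?thesis using that by (simp add: killing_invariant R_def)
    qed
    then show ?thesis by (simp add: R_def)
  qed
  have R_sub: "vec.subspace R"
    by (auto simp: vec.subspace_def R_def killing_linear_left)
  have "\<mu> z v \<in> I" if "v \<in> I" for z v
    using that unfolding I_def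
  proof (induction rule: vec.span_induct_alt)
    case base
    then show ?case by (simp add: vec.span_zero)
  next
    case (step c y w)
    then obtain p q where pq: "y = \<mu> p q" "p \<in> R" by blast
    have "\<mu> z y = \<mu> (\<mu> z p) q + \<mu> p (\<mu> z q)" unfolding pq by (rule leibniz)
    also have "\<dots> \<in> vec.span {\<mu> p q | p q. p \<in> R}"
      using R_ideal pq by (intro vec.span_add vec.span_base) blast+
    finally show ?case using step.IH
      unfolding add_right scale_right by (intro vec.span_add vec.span_scale)
  qed
  then have I: "lie_ideal \<mu> I" by (simp add: lie_ideal_def I_def)
  have "ad_nilpotent x" if "x \<in> I" for x
    using ad_nilpotent_of_trace that unfolding I_def R_def by simp
  then have "lie_solvable \<mu> I" by (intro nil_subalgebra_solvable engel I)
  then have "I = {0}" using I assms by (auto simp: lie_semisimple_def)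
  moreover have "\<mu> p q \<in> I" if "p \<in> R" for p q
    unfolding I_def by (rule vec.span_base) (use that in blast)
  ultimately have zero: "\<mu> p q = 0" if "p \<in> R" for p q
    using that by blast
  have "vec.span {\<mu> X Y | X Y. X \<in> R \<and> Y \<in> R} \<subseteq> {0}"
    by (rule vec.span_minimal) (use zero in \<open>auto simp: vec.subspace_single_0\<close>)
  then have "derived_series \<mu> R 1 \<subseteq> {0}" by simp
  moreover have "0 \<in> derived_series \<mu> R 1" by (simp add: vec.span_zero)
  ultimately have "derived_series \<mu> R 1 = {0}" by blast
  moreover have "lie_ideal \<mu> R" using R_sub R_ideal by (simp add: lie_ideal_def)
  ultimately have "R = {0}"
    using assms unfolding lie_semisimple_def lie_solvable_def by blast
  then show ?thesis by (auto simp: killing_nondegenerate_def R_def)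
qed

end

section \<open>Orbits of semisimple Lie algebras\<close>

lemma matrix_inv_vector [simp]:
  fixes g :: "complex^'n^('n::finite)"
  assumes "invertible g"
  shows "g *v (matrix_inv g *v x) = x" "matrix_inv g *v (g *v x) = x"
  using matrix_inv_mult[OF assms] by (simp_all add: matrix_vector_mul_assoc)

lemma invertible_matrix_inv [simp]:
  fixes g :: "complex^'n^('n::finite)"
  assumes "invertible g"
  shows "invertible (matrix_inv g)"
  using matrix_inv_mult[OF assms] by (auto simp: invertible_def)

lemma det_matrix_inv:
  fixes g :: "complex^'n^('n::finite)"
  assumes "invertible g"
  shows "det g * det (matrix_inv g) = 1"
  using matrix_inv_mult(1)[OF assms] by (metis det_I det_mul)

lemma bracket_action_eq_iff:
  assumes "invertible g"
  shows "bracket_action g \<mu> = \<nu> \<longleftrightarrow> (\<forall>x y. g *v \<mu> x y = \<nu> (g *v x) (g *v y))"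
proof
  assume *: "\<forall>x y. g *v \<mu> x y = \<nu> (g *v x) (g *v y)"
  have "bracket_action g \<mu> x y = \<nu> x y" for x y
    by (simp add: bracket_action_def * assms)
  then show "bracket_action g \<mu> = \<nu>" by blast
next
  assume *: "bracket_action g \<mu> = \<nu>"
  show "\<forall>x y. g *v \<mu> x y = \<nu> (g *v x) (g *v y)"
    unfolding *[symmetric] by (simp add: bracket_action_def assms)
qed

lemma bracket_action_mult:
  assumes "invertible g" "invertible h"
  shows "bracket_action (g ** h) \<mu> = bracket_action g (bracket_action h \<mu>)"
proof -
  have "invertible (g ** h)" using assms by (rule invertible_mult)
  then show ?thesis
    by (subst bracket_action_eq_iff) (simp_all add: bracket_action_def assms flip: matrix_vector_mul_assoc)
qed

lemma bracket_action_inv: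
  assumes "invertible g" "bracket_action g \<mu> = \<nu>"
  shows "bracket_action (matrix_inv g) \<nu> = \<mu>"
proof -
  have g: "g *v \<mu> x y = \<nu> (g *v x) (g *v y)" for x y
    using assms by (simp add: bracket_action_eq_iff)
  have "matrix_inv g *v \<nu> x y = \<mu> (matrix_inv g *v x) (matrix_inv g *v y)" for x y
    using arg_cong[OF g[of "matrix_inv g *v x" "matrix_inv g *v y"], of "(*v) (matrix_inv g)"] assms(1) by simp
  then show ?thesis using assms(1) by (simp add: bracket_action_eq_iff)
qed

lemma bracket_action_lie:
  assumes "invertible g" "\<mu> \<in> lie_brackets"
  shows "bracket_action g \<mu> \<in> lie_brackets"
proof -
  interpret lie_algebra \<mu> using assms by (simp add: lie_algebra_iff)
  have "bracket_action g \<mu> \<in> alternating_maps"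
    unfolding alternating_maps_def bracket_action_def
    by (auto intro!: clinearI simp: matrix_vector_right_distrib vector_scalar_commute add_left add_right scale_left scale_right)
  moreover have "bracket_action g \<mu> X (bracket_action g \<mu> Y Z) + bracket_action g \<mu> Y (bracket_action g \<mu> Z X)
      + bracket_action g \<mu> Z (bracket_action g \<mu> X Y) = 0" for X Y Z
    using assms(1) jacobi by (simp add: bracket_action_def flip: matrix_vector_right_distrib)
  ultimately show ?thesis by (simp add: lie_brackets_def)
qed

lemma special_linear_invertible: "g \<in> special_linear \<Longrightarrow> invertible g"
  by (simp add: special_linear_def invertible_det_nz)

lemma lie_brackets_alternating: "\<mu> \<in> lie_brackets \<Longrightarrow> \<mu> \<in> alternating_maps"
  by (simp add: lie_brackets_def)

context lie_algebra
begin

lemma killing_action: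
  assumes g: "invertible g" and \<nu>: "bracket_action g \<mu> = \<nu>"
  shows "killing \<nu> (g *v x) (g *v y) = killing \<mu> x y"
proof -
  have lin: "clinear (\<lambda>z. \<mu> x (\<mu> y (matrix_inv g *v z)))"
    by (rule clinearI) (simp_all add: matrix_vector_right_distrib vector_scalar_commute add_right scale_right)
  have "killing \<nu> (g *v x) (g *v y) = op_trace (\<lambda>z. g *v (\<mu> x (\<mu> y (matrix_inv g *v z))))"
    unfolding killing_def \<nu>[symmetric] bracket_action_def using g by simp
  also have "\<dots> = killing \<mu> x y"
    unfolding killing_def by (subst op_trace_commute[OF vec.linear_axioms lin]) (simp add: g)
  finally show ?thesis .
qed

lemma killing_expand: "killing \<mu> x y = (\<Sum>i\<in>UNIV. \<Sum>j\<in>UNIV. x $ i * y $ j * killing_matrix \<mu> $ i $ j)"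
proof -
  have "killing \<mu> x y = killing \<mu> (\<Sum>i\<in>UNIV. x $ i *s axis i 1) (\<Sum>j\<in>UNIV. y $ j *s axis j 1)"
    by (simp add: basis_expansion)
  also have "\<dots> = (\<Sum>j\<in>UNIV. \<Sum>i\<in>UNIV. x $ i * y $ j * killing_matrix \<mu> $ i $ j)"
    by (simp only: killing_sum_left killing_sum_right killing_linear_left killing_linear_right)
       (simp add: killing_matrix_def sum_distrib_left mult_ac)
  finally show ?thesis by (subst sum.swap)
qed

lemma killing_nondegenerate_iff: "killing_nondegenerate \<mu> \<longleftrightarrow> det (killing_matrix \<mu>) \<noteq> 0"
proof
  assume "killing_nondegenerate \<mu>"
  then interpret killing_lie_algebra \<mu> by unfold_locales
  show "det (killing_matrix \<mu>) \<noteq> 0"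
    using invertible_killing_matrix by (simp add: invertible_det_nz)
next
  assume "det (killing_matrix \<mu>) \<noteq> 0"
  then have inv: "invertible (killing_matrix \<mu>)" by (simp add: invertible_det_nz)
  show "killing_nondegenerate \<mu>"
    unfolding killing_nondegenerate_def
  proof (intro allI impI)
    fix x assume x: "\<forall>y. killing \<mu> x y = 0"
    have "(killing_matrix \<mu> *v x) $ i = killing \<mu> (axis i 1) (\<Sum>j\<in>UNIV. x $ j *s axis j 1)" for i
      by (simp only: killing_sum_right killing_linear_right)
         (simp add: killing_matrix_def matrix_vector_mult_def mult.commute)
    then have "killing_matrix \<mu> *v x = 0"
      using x killing_sym[of _ x] by (simp add: vec_eq_iff basis_expansion)
    then show "x = 0"
      using matrix_inv_vector(2)[OF inv, of x] by simp
  qed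
qed

end

text \<open>The Killing form is carried along by \<open>g\<close>, so the two Gram matrices are
  congruent; \<open>g\<close> enters once on each side, which produces the square.\<close>

lemma det_killing_matrix_action:
  assumes \<mu>: "\<mu> \<in> lie_brackets" and g: "invertible g" and \<nu>: "bracket_action g \<mu> = \<nu>"
  shows "det (killing_matrix \<mu>) = (det g)\<^sup>2 * det (killing_matrix \<nu>)"
proof -
  interpret \<mu>: lie_algebra \<mu> using \<mu> by (simp add: lie_algebra_iff)
  interpret \<nu>: lie_algebra \<nu> using bracket_action_lie[OF g \<mu>] \<nu> by (simp add: lie_algebra_iff)
  have col: "(g *v axis i 1) $ k = g $ k $ i" for i k
    by (simp only: matrix_mult_sum sum_axis column_def vec_lambda_beta)
  have "killing_matrix \<mu> = transpose g ** (killing_matrix \<nu> ** g)"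
    by (simp add: vec_eq_iff killing_matrix_def[of \<mu>] \<mu>.killing_action[OF g \<nu>, symmetric] \<nu>.killing_expand col
        matrix_matrix_mult_def transpose_def sum_distrib_left mult_ac)
  then show ?thesis
    by (simp add: det_mul det_transpose power2_eq_square)
qed

lemma continuous_on_bracket_eval: "continuous_on S (\<lambda>\<mu>::('n::finite) bracket. \<mu> X Y)"
proof -
  have "continuous_on UNIV (\<lambda>\<mu>::'n bracket. \<mu> X Y)"
    by (rule continuous_on_product_then_coordinatewise)
       (rule continuous_on_product_coordinates)
  then show ?thesis by (rule continuous_on_subset) simp
qed

lemma continuous_on_sc: "continuous_on S (sc :: ('n::finite) bracket \<Rightarrow> _)"
  unfolding structure_constants_def
  by (intro continuous_intros continuous_on_bracket_eval)

lemma continuous_on_br_eval: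
  assumes "continuous_on S f" "continuous_on S g" "continuous_on S h"
  shows "continuous_on S (\<lambda>x. br (f x) (g x) (h x))"
  unfolding bracket_of_constants_def vector_scalar_mult_def
  by (intro continuous_intros assms)

lemma continuous_on_det_killing_matrix:
  assumes "continuous_on S f"
  shows "continuous_on S (\<lambda>x. det (killing_matrix (br (f x))))"
  unfolding killing_matrix_def killing_def op_trace_def
  by (intro continuous_on_det continuous_intros continuous_on_br_eval assms)

text \<open>\<open>G\<close> remains a parameter: it is the whole matrix space for openness of an
  orbit, and a half-plane condition on the determinant for closedness.\<close>

lemma local_orbit:
  assumes \<mu>: "\<mu> \<in> lie_brackets" "det (killing_matrix \<mu>) \<noteq> 0" and G: "open G" "mat 1 \<in> G"
  shows "\<exists>T. open T \<and> \<mu> \<in> T \<and> (\<forall>\<nu>\<in>T \<inter> lie_brackets. \<exists>g\<in>G. invertible g \<and> bracket_action g \<nu> = \<mu>)"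
proof -
  interpret lie_algebra \<mu> using \<mu> by (simp add: lie_algebra_iff)
  interpret killing_lie_algebra \<mu> using \<mu> by unfold_locales (simp add: killing_nondegenerate_iff)
  obtain d where d: "d > 0" "\<And>\<nu>. \<nu> \<in> lie_brackets \<Longrightarrow> dist (sc \<nu>) (sc \<mu>) < d \<Longrightarrow>
      \<exists>g\<in>G. invertible g \<and> (\<forall>x y. g *v \<nu> x y = \<mu> (g *v x) (g *v y))"
    using rigidity[OF G] by blast
  have "open {\<nu>. dist (sc \<nu>) (sc \<mu>) < d}"
    by (intro open_Collect_less continuous_intros continuous_on_sc)
  moreover have "\<exists>g\<in>G. invertible g \<and> bracket_action g \<nu> = \<mu>"
    if "\<nu> \<in> {\<nu>. dist (sc \<nu>) (sc \<mu>) < d} \<inter> lie_brackets" for \<nu>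
    using d(2)[of \<nu>] that bracket_action_eq_iff by blast
  moreover have "\<mu> \<in> {\<nu>. dist (sc \<nu>) (sc \<mu>) < d}" using d(1) by simp
  ultimately show ?thesis by blast
qed

lemma semisimple_det_killing_matrix:
  assumes "\<mu> \<in> lie_brackets" "lie_semisimple \<mu>"
  shows "det (killing_matrix \<mu>) \<noteq> 0"
proof -
  interpret lie_algebra \<mu> using assms by (simp add: lie_algebra_iff)
  show ?thesis using cartan_criterion assms by (simp add: killing_nondegenerate_iff)
qed

lemma general_linear_orbit_open:
  assumes \<mu>: "\<mu> \<in> lie_brackets" "lie_semisimple \<mu>"
  shows "openin (top_of_set lie_brackets) (bracket_orbit general_linear \<mu>)"
proof (subst openin_subopen, intro ballI)
  fix \<nu> assume "\<nu> \<in> bracket_orbit general_linear \<mu>"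
  then obtain h where h: "invertible h" "\<nu> = bracket_action h \<mu>"
    by (auto simp: bracket_orbit_def general_linear_def)
  have \<nu>: "\<nu> \<in> lie_brackets" using h bracket_action_lie \<mu> by blast
  \<comment> \<open>Rigidity is wanted at \<open>\<nu>\<close>, not at \<open>\<mu>\<close>. The
    Killing determinant carries nondegeneracy along the orbit.\<close>
  have "det (killing_matrix \<nu>) \<noteq> 0"
    using det_killing_matrix_action[OF \<mu>(1) h(1) h(2)[symmetric]] semisimple_det_killing_matrix[OF \<mu>] by auto
  then obtain T where T: "open T" "\<nu> \<in> T"
    "\<And>\<nu>'. \<nu>' \<in> T \<Longrightarrow> \<nu>' \<in> lie_brackets \<Longrightarrow> \<exists>g. invertible g \<and> bracket_action g \<nu>' = \<nu>"
    using local_orbit[OF \<nu> _ open_UNIV UNIV_I] by blast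
  have "lie_brackets \<inter> T \<subseteq> bracket_orbit general_linear \<mu>"
  proof
    fix \<nu>' assume "\<nu>' \<in> lie_brackets \<inter> T"
    then obtain g where g: "invertible g" "bracket_action g \<nu>' = \<nu>" using T(3) by blast
    have "\<nu>' = bracket_action (matrix_inv g ** h) \<mu>"
      using bracket_action_inv[OF g] h bracket_action_mult[OF invertible_matrix_inv[OF g(1)] h(1)] by simp
    moreover have "invertible (matrix_inv g ** h)"
      using g h by (intro invertible_mult) simp_all
    ultimately show "\<nu>' \<in> bracket_orbit general_linear \<mu>"
      by (auto simp: bracket_orbit_def general_linear_def)
  qed
  then show "\<exists>T. openin (top_of_set lie_brackets) T \<and> \<nu> \<in> T \<and> T \<subseteq> bracket_orbit general_linear \<mu>"
    using T \<nu> by (intro exI[of _ "lie_brackets \<inter> T"]) (auto intro: openin_open_Int)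
qed

text \<open>A point off the orbit violates the Jacobi identity, or has another Killing determinant,
  or neither. The first two are open conditions that fail on the orbit; in the third case an orbit
  point too close would, by rigidity, put the point itself on the orbit.\<close>

lemma special_linear_orbit_closed:
  assumes \<mu>: "\<mu> \<in> lie_brackets" "lie_semisimple \<mu>"
  shows "closedin (top_of_set alternating_maps) (bracket_orbit special_linear \<mu>)"
proof -
  \<comment> \<open>For arbitrary functions, a nested evaluation of the bracket is not continuous
    under pointwise convergence. Through \<open>br (sc \<nu>)\<close> the determinant becomes a
    polynomial in the structure constants, and on bilinear brackets its value is unchanged.\<close>
  let ?O = "bracket_orbit special_linear \<mu>" and ?\<kappa> = "\<lambda>\<nu>. det (killing_matrix (br (sc \<nu>)))"
  have O_lie: "\<rho> \<in> lie_brackets" if "\<rho> \<in> ?O" for \<rho>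
    using that bracket_action_lie special_linear_invertible \<mu>(1) by (auto simp: bracket_orbit_def)
  have O_br: "br (sc \<rho>) = \<rho>" if "\<rho> \<in> lie_brackets" for \<rho>
    using that by (simp add: alternating_maps_expand lie_brackets_alternating)
  have O_det: "det (killing_matrix \<rho>) = det (killing_matrix \<mu>)" if \<rho>: "\<rho> \<in> ?O" for \<rho>
  proof -
    obtain g where g: "g \<in> special_linear" "\<rho> = bracket_action g \<mu>"
      using \<rho> by (auto simp: bracket_orbit_def)
    then show ?thesis
      using det_killing_matrix_action[OF \<mu>(1) special_linear_invertible[OF g(1)], of \<rho>]
      by (simp add: special_linear_def)
  qed
  have "\<exists>U. open U \<and> \<nu> \<in> U \<and> U \<inter> ?O = {}" if \<nu>: "\<nu> \<in> alternating_maps" "\<nu> \<notin> ?O" for \<nu>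
  proof (cases "\<nu> \<in> lie_brackets")
    case False
    let ?J = "\<lambda>\<rho>. jacobiator (br (sc \<rho>)) (br (sc \<rho>))"
    obtain X Y Z where "jacobiator \<nu> \<nu> X Y Z \<noteq> 0"
      using False \<nu>(1) by (auto simp: lie_brackets_def jacobiator_def)
    then have "?J \<nu> X Y Z \<noteq> 0" using \<nu>(1) by (simp add: alternating_maps_expand)
    moreover have "open {\<rho>. ?J \<rho> X Y Z \<noteq> 0}"
      unfolding jacobiator_def
      by (intro open_Collect_neq continuous_intros continuous_on_br_eval continuous_on_sc)
    moreover have "?J \<rho> X Y Z = 0" if "\<rho> \<in> ?O" for \<rho>
      using O_lie[OF that] O_br[OF O_lie[OF that]] by (simp add: lie_brackets_def jacobiator_def)
    ultimately show ?thesis by (intro exI[of _ "{\<rho>. ?J \<rho> X Y Z \<noteq> 0}"]) auto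
  next
    case True
    show ?thesis
    proof (cases "det (killing_matrix \<nu>) = det (killing_matrix \<mu>)")
      case False
      then have "?\<kappa> \<nu> \<noteq> det (killing_matrix \<mu>)" using True by (simp add: O_br)
      moreover have "open {\<rho>. ?\<kappa> \<rho> \<noteq> det (killing_matrix \<mu>)}"
        by (intro open_Collect_neq continuous_intros continuous_on_det_killing_matrix continuous_on_sc)
      moreover have "?\<kappa> \<rho> = det (killing_matrix \<mu>)" if "\<rho> \<in> ?O" for \<rho>
        using O_br[OF O_lie[OF that]] O_det[OF that] by simp
      ultimately show ?thesis by (intro exI[of _ "{\<rho>. ?\<kappa> \<rho> \<noteq> det (killing_matrix \<mu>)}"]) auto
    next
      case eq: True
      \<comment> \<open>A neighbourhood of the identity on which the determinant cannot be -1, the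
        other root of \<open>(det g)\<^sup>2 = 1\<close>.\<close>
      let ?G = "{g :: complex^'n^'n. 0 < Re (det g)}"
      have G: "open ?G"
        by (intro open_Collect_less continuous_intros continuous_on_det)
      have G1: "mat 1 \<in> ?G" by simp
      have nz: "det (killing_matrix \<nu>) \<noteq> 0"
        using eq semisimple_det_killing_matrix[OF \<mu>] by simp
      obtain T where T: "open T" "\<nu> \<in> T"
        "\<forall>\<nu>'\<in>T \<inter> lie_brackets. \<exists>g\<in>?G. invertible g \<and> bracket_action g \<nu>' = \<nu>"
        using local_orbit[OF True nz G G1] by blast
      have "\<rho> \<notin> T" if \<rho>: "\<rho> \<in> ?O" for \<rho>
      proof
        assume "\<rho> \<in> T"
        then obtain g where g: "0 < Re (det g)" "invertible g" "bracket_action g \<rho> = \<nu>"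
          using T(3) O_lie[OF \<rho>] by blast
        obtain h where h: "h \<in> special_linear" "\<rho> = bracket_action h \<mu>"
          using \<rho> by (auto simp: bracket_orbit_def)
        have "(det g)\<^sup>2 = 1"
          using det_killing_matrix_action[OF O_lie[OF \<rho>] g(2,3)] O_det[OF \<rho>] eq nz by simp
        then have "det g = 1"
          using g(1) by (auto simp: power2_eq_1_iff)
        moreover have "\<nu> = bracket_action (g ** h) \<mu>"
          using g h bracket_action_mult[OF g(2) special_linear_invertible[OF h(1)]] by simp
        ultimately show False
          using \<nu>(2) h(1) by (auto simp: bracket_orbit_def special_linear_def det_mul)
      qed
      then show ?thesis using T by blast
    qed
  qed
  note separated = this
  have "openin (top_of_set alternating_maps) (alternating_maps - ?O)"
  proof (subst openin_subopen, intro ballI)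
    fix \<nu> assume \<nu>: "\<nu> \<in> alternating_maps - ?O"
    then obtain U where U: "open U" "\<nu> \<in> U" "U \<inter> ?O = {}" using separated by blast
    then have "\<nu> \<in> alternating_maps \<inter> U" "alternating_maps \<inter> U \<subseteq> alternating_maps - ?O"
      using \<nu> by auto
    then show "\<exists>T. openin (top_of_set alternating_maps) T \<and> \<nu> \<in> T \<and> T \<subseteq> alternating_maps - ?O"
      using openin_open_Int[OF U(1)] by blast
  qed
  moreover have "?O \<subseteq> alternating_maps" using O_lie lie_brackets_alternating by blast
  ultimately show ?thesis by (simp add: closedin_def)
qed

section \<open>Degeneration of non-semisimple Lie algebras\<close>

lemma (in lie_algebra) derived_series_ideal:
  assumes "lie_ideal \<mu> I"
  shows "lie_ideal \<mu> (derived_series \<mu> I k)"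
proof (induction k)
  case 0
  then show ?case using assms by simp
next
  case (Suc k)
  let ?D = "derived_series \<mu> I k"
  let ?S = "{\<mu> X Y | X Y. X \<in> ?D \<and> Y \<in> ?D}"
  have D: "\<mu> x y \<in> ?D" if "y \<in> ?D" for x y
    using Suc that by (simp add: lie_ideal_def)
  have "\<mu> z v \<in> vec.span ?S" if "v \<in> vec.span ?S" for z v
    using that
  proof (induction rule: vec.span_induct_alt)
    case base
    then show ?case by (simp add: vec.span_zero)
  next
    case (step c y w)
    then obtain a b where ab: "y = \<mu> a b" "a \<in> ?D" "b \<in> ?D" by blast
    have "\<mu> z y = \<mu> (\<mu> z a) b + \<mu> a (\<mu> z b)" unfolding ab by (rule leibniz)
    also have "\<dots> \<in> vec.span ?S"
      by (intro vec.span_add vec.span_base) (use D ab in blast)+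
    finally show ?case using step.IH
      unfolding add_right scale_right by (intro vec.span_add vec.span_scale)
  qed
  then show ?case by (simp add: lie_ideal_def)
qed

text \<open>Take the last nonzero term of the derived series of a nonzero solvable ideal; every term
  is an ideal of the whole algebra by Leibniz.\<close>

lemma (in lie_algebra) abelian_ideal:
  assumes "\<not> lie_semisimple \<mu>"
  obtains I where "lie_ideal \<mu> I" "I \<noteq> {0}" "\<And>x y. x \<in> I \<Longrightarrow> y \<in> I \<Longrightarrow> \<mu> x y = 0"
proof -
  obtain I k where I: "lie_ideal \<mu> I" "derived_series \<mu> I k = {0}" "I \<noteq> {0}"
    using assms unfolding lie_semisimple_def lie_solvable_def by blast
  define m where "m = (LEAST k. derived_series \<mu> I k = {0})"
  have m: "derived_series \<mu> I m = {0}" unfolding m_def using I(2) by (rule LeastI)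
  then obtain j where j: "m = Suc j" using I(3) by (cases m) auto
  let ?D = "derived_series \<mu> I j"
  have "?D \<noteq> {0}"
    using not_less_Least[of j "\<lambda>k. derived_series \<mu> I k = {0}"] j m_def by simp
  moreover have "\<mu> x y = 0" if "x \<in> ?D" "y \<in> ?D" for x y
  proof -
    have "\<mu> x y \<in> derived_series \<mu> I (Suc j)"
      unfolding derived_series.simps by (rule vec.span_base) (use that in blast)
    then show ?thesis using m j by simp
  qed
  ultimately show thesis using that derived_series_ideal[OF I(1)] by blast
qed

text \<open>The columns of \<open>M\<close> extend a basis of \<open>I\<close>, and \<open>J\<close>
  marks those from that basis. The last two conclusions together say that \<open>M\<close> carries
  the coordinate subspace of \<open>J\<close> onto \<open>I\<close>.\<close>

lemma adapted_matrix:
  fixes I :: "(complex^'n::finite) set"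
  assumes "vec.subspace I" "I \<noteq> {0}"
  obtains M :: "complex^'n^'n" and J where "invertible M" "J \<noteq> {}"
    "\<And>j. j \<in> J \<Longrightarrow> M *v axis j 1 \<in> I"
    "\<And>v k. v \<in> I \<Longrightarrow> k \<notin> J \<Longrightarrow> (matrix_inv M *v v) $ k = 0"
proof -
  obtain B0 where B0: "B0 \<subseteq> I" "vec.independent B0" "I \<subseteq> vec.span B0"
    using vec.basis_exists by metis
  have span0: "vec.span B0 = I"
    using B0 vec.span_minimal[OF B0(1) assms(1)] by blast
  let ?B = "vec.extend_basis B0"
  have B: "B0 \<subseteq> ?B" "vec.independent ?B" "vec.span ?B = UNIV"
    using vec.extend_basis_superset[OF B0(2)] vec.independent_extend_basis[OF B0(2)] vec.span_extend_basis[OF B0(2)]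
    by auto
  have "card ?B = CARD('n)"
    using vec.dim_span_eq_card_independent[OF B(2)] B(3) by (simp add: vec_dim_card del: vec.dim_UNIV)
  moreover have "finite ?B" by (rule vec.finiteI_independent[OF B(2)])
  ultimately obtain f :: "'n \<Rightarrow> complex^'n" where f: "bij_betw f UNIV ?B"
    using finite_same_card_bij[of "UNIV :: 'n set" ?B] by auto
  define M :: "complex^'n^'n" where "M = (\<chi> i j. f j $ i)"
  define J where "J = {j. f j \<in> B0}"
  have M: "M *v axis j 1 = f j" for j
    by (simp only: matrix_mult_sum sum_axis) (simp add: column_def M_def vec_eq_iff)
  have "vec.subspace (range ((*v) M))"
    by (rule vec.subspace_image) (rule vec.subspace_UNIV)
  moreover have "?B \<subseteq> range ((*v) M)"
  proof
    fix b assume "b \<in> ?B"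
    then obtain j where "b = f j" using f by (auto simp: bij_betw_def)
    then show "b \<in> range ((*v) M)" by (metis M rangeI)
  qed
  ultimately have "surj ((*v) M)" using B(3) vec.span_minimal by blast
  then have inv: "invertible M"
    by (metis invertible_right_inverse matrix_right_invertible_surjective)
  have "B0 \<noteq> {}" using span0 assms(2) by auto
  then obtain b where b: "b \<in> B0" by blast
  then obtain j where "b = f j" using f B(1) by (auto simp: bij_betw_def)
  with b have "J \<noteq> {}" by (auto simp: J_def)
  moreover have "M *v axis j 1 \<in> I" if "j \<in> J" for j
    using that B0(1) by (auto simp: M J_def)
  moreover have "(matrix_inv M *v v) $ k = 0" if v: "v \<in> I" and k: "k \<notin> J" for v k
  proof -
    have "v \<in> vec.span B0" using v span0 by simp
    then show ?thesis
    proof (induction rule: vec.span_induct_alt)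
      case base
      then show ?case by simp
    next
      case (step c y w)
      have "y \<in> ?B" using step.hyps(1) B(1) by blast
      then obtain j where j: "y = f j" using f by (auto simp: bij_betw_def)
      then have "j \<in> J" using step.hyps(1) by (simp add: J_def)
      have "matrix_inv M *v y = axis j 1"
        using matrix_inv_vector(2)[OF inv, of "axis j 1"] by (simp add: M j)
      then have "(matrix_inv M *v y) $ k = 0" using \<open>j \<in> J\<close> k by (auto simp: axis_def)
      then show ?case
        using step.IH by (simp add: matrix_vector_right_distrib vector_scalar_commute)
    qed
  qed
  ultimately show thesis using inv that by blast
qed

text \<open>As \<open>t\<close> tends to 0, the axes in \<open>J\<close> are contracted and the others expanded; the exponents
  are chosen to make the determinant equal to 1.\<close>

definition torus :: "'n set \<Rightarrow> real \<Rightarrow> 'n::finite \<Rightarrow> real" where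
  "torus J t i = (if i \<in> J then t ^ card (- J) else 1 / t ^ card J)"

definition torus_matrix :: "'n set \<Rightarrow> real \<Rightarrow> complex^'n^'n::finite" where
  "torus_matrix J t = (\<chi> i j. if i = j then of_real (torus J t i) else 0)"

lemma det_torus_matrix:
  assumes "t > 0"
  shows "det (torus_matrix J t) = 1"
proof -
  have "det (torus_matrix J t) = of_real (\<Prod>i\<in>UNIV. torus J t i)"
    by (subst det_diagonal) (simp_all add: torus_matrix_def)
  also have "(\<Prod>i\<in>UNIV. torus J t i) = (\<Prod>i\<in>J. torus J t i) * (\<Prod>i\<in>-J. torus J t i)"
    using prod.union_disjoint[of J "- J" "torus J t"] by (simp add: Compl_partition)
  also have "\<dots> = 1"
    using assms by (simp add: torus_def power_divide flip: power_mult) (simp add: mult.commute)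
  finally show ?thesis by simp
qed

lemma torus_matrix_mult: "torus_matrix J t *v x = (\<chi> i. of_real (torus J t i) * x $ i)"
  by (simp add: vec_eq_iff matrix_vector_mult_def torus_matrix_def if_distribR if_distrib cong: if_cong)

lemma torus_weight_bound:
  assumes t: "0 < t" "t \<le> 1" and J: "J \<noteq> {}" and "i \<notin> J \<or> j \<notin> J" "(i \<in> J \<or> j \<in> J) \<longrightarrow> k \<in> J"
  shows "torus J t k / (torus J t i * torus J t j) \<le> t"
proof -
  have "card J \<noteq> 0" using J by simp
  then have pos: "card J \<ge> 1" by linarith
  have le: "t ^ n \<le> t" if "n \<ge> 1" for n
    using power_decreasing[of 1 n t] t that by simp
  have le2: "t ^ a * t ^ b \<le> t" if "b \<ge> 1" for a b
    using le[of "a + b"] that by (simp add: power_add)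
  have "t ^ card (- J) * (t ^ card J * t ^ card J) \<le> t"
    using le2[of "card J" "card (- J) + card J"] pos by (simp add: power_add mult.assoc)
  then show ?thesis
    using assms le[OF pos] by (auto simp: torus_def)
qed

lemma degeneration:
  fixes \<nu> :: "('n::finite) bracket"
  assumes \<nu>: "\<nu> \<in> lie_brackets" "\<not> lie_semisimple \<nu>" and U: "open U" "zero_bracket \<in> U"
  shows "\<exists>g\<in>special_linear. bracket_action g \<nu> \<in> U"
proof -
  interpret lie_algebra \<nu> using \<nu> by (simp add: lie_algebra_iff)
  obtain I where I: "lie_ideal \<nu> I" "I \<noteq> {0}" and ab: "\<And>x y. x \<in> I \<Longrightarrow> y \<in> I \<Longrightarrow> \<nu> x y = 0"
    using abelian_ideal[OF \<nu>(2)] by blast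
  have sub: "vec.subspace I" and ideal: "\<And>x y. y \<in> I \<Longrightarrow> \<nu> x y \<in> I"
    using I by (auto simp: lie_ideal_def)
  obtain M :: "complex^'n^'n" and J where M: "invertible M" and J: "J \<noteq> {}"
    and MJ: "\<And>j. j \<in> J \<Longrightarrow> M *v axis j 1 \<in> I"
    and Mk: "\<And>v k. v \<in> I \<Longrightarrow> k \<notin> J \<Longrightarrow> (matrix_inv M *v v) $ k = 0"
    using adapted_matrix[OF sub I(2)] by blast
  define c where "c = sc (bracket_action (matrix_inv M) \<nu>)"
  have inv2: "matrix_inv (matrix_inv M) *v x = M *v x" for x
    using matrix_inv_vector(2)[OF invertible_matrix_inv[OF M], of "M *v x"] M by simp
  have c: "c $ i $ j = matrix_inv M *v \<nu> (M *v axis i 1) (M *v axis j 1)" for i j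
    by (simp add: c_def structure_constants_def bracket_action_def inv2)
  have brc: "br c = bracket_action (matrix_inv M) \<nu>"
    unfolding c_def
    by (intro alternating_maps_expand lie_brackets_alternating bracket_action_lie \<nu> invertible_matrix_inv M)
  \<comment> \<open>Both indices in \<open>J\<close>: \<open>I\<close> is abelian. One index in
    \<open>J\<close> and \<open>k\<close> outside: \<open>I\<close> is an ideal.\<close>
  have c0: "c $ i $ j $ k = 0" if "(i \<in> J \<and> j \<in> J) \<or> ((i \<in> J \<or> j \<in> J) \<and> k \<notin> J)" for i j k
  proof (cases "i \<in> J \<and> j \<in> J")
    case True
    then show ?thesis by (simp add: c ab MJ)
  next
    case False
    then have k: "k \<notin> J" and "i \<in> J \<or> j \<in> J" using that by auto
    then have "\<nu> (M *v axis i 1) (M *v axis j 1) \<in> I"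
      using ideal MJ vec.subspace_neg[OF sub] skew by metis
    then show ?thesis using Mk k by (simp add: c)
  qed
  define d where "d t = (\<chi> i j k. of_real (torus J t k / (torus J t i * torus J t j)) * c $ i $ j $ k)" for t
  have d: "bracket_action (torus_matrix J t) (br c) = br (d t)" if t: "t > 0" for t
  proof -
    have inv: "invertible (torus_matrix J t)"
      using det_torus_matrix[OF t, of J] by (simp add: invertible_det_nz)
    have nz: "torus J t i \<noteq> 0" for i using t by (simp add: torus_def)
    have "torus_matrix J t *v br c x y = br (d t) (torus_matrix J t *v x) (torus_matrix J t *v y)" for x y
      by (simp add: vec_eq_iff torus_matrix_mult bracket_of_constants_def d_def sum_distrib_left nz field_simps)
    then show ?thesis using inv by (simp add: bracket_action_eq_iff)
  qed
  have d_bound: "cmod (d t $ i $ j $ k) \<le> t * cmod (c $ i $ j $ k)" if t: "0 < t" "t \<le> 1" for t i j k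
  proof (cases "(i \<in> J \<and> j \<in> J) \<or> ((i \<in> J \<or> j \<in> J) \<and> k \<notin> J)")
    case True
    then show ?thesis by (simp add: d_def c0)
  next
    case False
    have pos: "torus J t i > 0" for i using t by (simp add: torus_def)
    have "\<bar>torus J t k / (torus J t i * torus J t j)\<bar> \<le> t"
      using torus_weight_bound[OF t J, of i j k] False pos[of i] pos[of j] pos[of k] by auto
    then have "\<bar>torus J t k / (torus J t i * torus J t j)\<bar> * cmod (c $ i $ j $ k) \<le> t * cmod (c $ i $ j $ k)"
      by (intro mult_right_mono) auto
    then show ?thesis by (simp add: d_def norm_mult norm_divide abs_mult)
  qed
  have "(\<lambda>n. d (inverse (real (Suc n)))) \<longlonglongrightarrow> 0"
  proof (intro vec_tendstoI)
    fix i j k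
    have "(\<lambda>n. d (inverse (real (Suc n))) $ i $ j $ k) \<longlonglongrightarrow> 0"
    proof (rule Lim_null_comparison)
      show "\<forall>\<^sub>F n in sequentially. cmod (d (inverse (real (Suc n))) $ i $ j $ k) \<le> inverse (real (Suc n)) * cmod (c $ i $ j $ k)"
        by (intro always_eventually allI d_bound) (auto simp: field_simps)
      show "(\<lambda>n. inverse (real (Suc n)) * cmod (c $ i $ j $ k)) \<longlonglongrightarrow> 0"
        by (rule tendsto_mult_left_zero[OF LIMSEQ_inverse_real_of_nat])
    qed
    then show "(\<lambda>n. d (inverse (real (Suc n))) $ i $ j $ k) \<longlonglongrightarrow> 0 $ i $ j $ k" by simp
  qed
  moreover have "open ((\<lambda>c. bracket_action M (br c)) -` U)"
  proof (rule open_vimage[OF U(1)])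
    show "continuous_on UNIV (\<lambda>c. bracket_action M (br c))"
      unfolding bracket_action_def matrix_vector_mult_def
      by (intro continuous_on_coordinatewise_then_product continuous_intros continuous_on_br_eval)
  qed
  moreover have "0 \<in> (\<lambda>c. bracket_action M (br c)) -` U"
  proof -
    have "bracket_action M (br 0) = zero_bracket"
      by (simp add: bracket_action_def zero_bracket_def)
    then show ?thesis using U(2) by simp
  qed
  ultimately have "\<forall>\<^sub>F n in sequentially. d (inverse (real (Suc n))) \<in> (\<lambda>c. bracket_action M (br c)) -` U"
    by (rule topological_tendstoD)
  then obtain n where "d (inverse (real (Suc n))) \<in> (\<lambda>c. bracket_action M (br c)) -` U"
    using eventually_happens'[OF sequentially_bot] by blast
  moreover define t where "t = inverse (real (Suc n))"
  ultimately have t: "t > 0" "bracket_action M (br (d t)) \<in> U"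
    by simp_all
  have T: "invertible (torus_matrix J t)"
    using det_torus_matrix[OF t(1), of J] by (simp add: invertible_det_nz)
  \<comment> \<open>\<open>M\<close> may have any nonzero determinant, but the conjugate of the
    torus element has determinant 1. The final factor \<open>M\<close> is harmless because its
    action is continuous and fixes the zero bracket.\<close>
  let ?g = "M ** (torus_matrix J t ** matrix_inv M)"
  have "bracket_action ?g \<nu> = bracket_action M (br (d t))"
    using M T by (simp add: bracket_action_mult invertible_mult d[OF t(1), symmetric] brc)
  moreover have "det ?g = 1"
    using det_matrix_inv[OF M] det_torus_matrix[OF t(1), of J] by (simp add: det_mul)
  ultimately show ?thesis using t(2) by (metis (mono_tags, lifting) mem_Collect_eq special_linear_def)
qed

lemma zero_in_orbit_closure:
  fixes \<nu> :: "('n::finite) bracket"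
  assumes \<nu>: "\<nu> \<in> lie_brackets" "\<not> lie_semisimple \<nu>"
  shows "zero_bracket \<in> (top_of_set alternating_maps) closure_of (bracket_orbit special_linear \<nu>)"
  unfolding in_closure_of
proof (intro conjI allI impI)
  show "zero_bracket \<in> topspace (top_of_set alternating_maps)"
    by (auto simp: alternating_maps_def zero_bracket_def intro!: clinearI)
  fix T :: "'n bracket set" assume "zero_bracket \<in> T \<and> openin (top_of_set alternating_maps) T"
  then obtain U where U: "open U" "T = alternating_maps \<inter> U" "zero_bracket \<in> U"
    by (auto simp: openin_open)
  then obtain g where g: "g \<in> special_linear" "bracket_action g \<nu> \<in> U"
    using degeneration[OF \<nu>] by blast
  moreover have "bracket_action g \<nu> \<in> alternating_maps"
    using bracket_action_lie[OF special_linear_invertible[OF g(1)] \<nu>(1)] by (rule lie_brackets_alternating)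
  ultimately show "\<exists>y. y \<in> bracket_orbit special_linear \<nu> \<and> y \<in> T"
    using U by (auto simp: bracket_orbit_def)
qed

lemma bracket_action_zero_iff:
  assumes "invertible g" "bracket_action g \<mu> = zero_bracket"
  shows "\<mu> = zero_bracket"
  using bracket_action_inv[OF assms] by (auto simp: bracket_action_def zero_bracket_def)

text \<open>A closed orbit of a non-semisimple bracket would contain the zero bracket; as that is
  fixed by every invertible matrix, the bracket itself would be zero.\<close>

lemma special_linear_orbit_closed_iff:
  assumes \<mu>: "\<mu> \<in> lie_brackets" "\<mu> \<noteq> zero_bracket"
  shows "closedin (top_of_set alternating_maps) (bracket_orbit special_linear \<mu>) \<longleftrightarrow> lie_semisimple \<mu>"
proof
  assume closed: "closedin (top_of_set alternating_maps) (bracket_orbit special_linear \<mu>)"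
  show "lie_semisimple \<mu>"
  proof (rule ccontr)
    assume "\<not> lie_semisimple \<mu>"
    then have "zero_bracket \<in> bracket_orbit special_linear \<mu>"
      using zero_in_orbit_closure[OF \<mu>(1)] closure_of_closedin[OF closed] by simp
    then obtain g where "g \<in> special_linear" "bracket_action g \<mu> = zero_bracket"
      by (auto simp: bracket_orbit_def)
    then show False using bracket_action_zero_iff special_linear_invertible \<mu>(2) by blast
  qed
qed (rule special_linear_orbit_closed[OF \<mu>(1)])

theorem corollary6p2:
  shows "(\<forall>\<mu> \<in> (lie_brackets :: ('n::finite) bracket set). lie_semisimple \<mu> \<longrightarrow>
            openin (top_of_set lie_brackets) (bracket_orbit general_linear \<mu>)) \<and>
         (\<forall>\<mu> \<in> (lie_brackets :: 'n bracket set). \<mu> \<noteq> zero_bracket \<longrightarrow>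
            (closedin (top_of_set alternating_maps) (bracket_orbit special_linear \<mu>)
               \<longleftrightarrow> lie_semisimple \<mu>)) \<and>
         (\<forall>\<nu> \<in> (lie_brackets :: 'n bracket set). \<not> lie_semisimple \<nu> \<longrightarrow>
            zero_bracket \<in>
              (top_of_set alternating_maps) closure_of (bracket_orbit special_linear \<nu>))"
  using general_linear_orbit_open special_linear_orbit_closed_iff zero_in_orbit_closure by blast

end
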